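(* Let $g=1+\sum_{|\alpha|\ge1}b_\alpha Z_\alpha$ be an admissible free holomorphic function with $g^{-1}=1+\sum_{|\alpha|\ge1}a_\alpha Z_\alpha$, let ${\bf W}=(W_1,\ldots,W_n)$ be the weighted left creation operators associated with $g$, and assume that $\sum_{k=0}^\infty\sum_{|\alpha|=k}a_\alpha W_\alpha W_\alpha^*$ is convergent in the operator norm topology. Let $\pi$ be a unital $*$-representation of $C^*({\bf W})$ on a separable Hilbert space $\mathcal K$ and let $V:=(V_1,\ldots,V_n)$, where $V_i:=\pi(W_i)$. If $\pi$ is not a Cuntz type $*$-representation, then the $C^*$-algebras $C^*({\bf W})$ and $C^*(V)$ are $*$-isomorphic.
   Context: $\mathbb F_n^+$ is the unital free semigroup on generators $g_1,\ldots,g_n$ with identity $g_0$, and $|\alpha|$ is the length of $\alpha$. For $\alpha=g_{i_1}\cdots g_{i_k}$, $X_\alpha:=X_{i_1}\cdots X_{i_k}$, $X_{g_0}:=I$. $F^2(H_n)$ is the full Fock space with orthonormal basis $\{e_\alpha\}_{\alpha\in\mathbb F_n^+}$. A formal power series $\sum_\alpha c_\alpha Z_\alpha$ in noncommuting indeterminates is a free holomorphic function in a neighborhood of the origin if there is $\rho>0$ such that $\sum_{k}\sum_{|\alpha|=k}c_\alpha X_\alpha$ converges in norm for every Hilbert space $\mathcal H$ and every $X\in B(\mathcal H)^n$ with $\|\sum_iX_iX_i^*\|^{1/2}\le\rho$; equivalently $\limsup_k(\sum_{|\alpha|=k}|c_\alpha|^2)^{1/2k}<\infty$. $g$ is admissible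 if: (a) $b_{g_0}=1$, all $b_\alpha>0$, and $\sup_\alpha b_\alpha/b_{g_i\alpha}<\infty$ for each $i$; (b) $g$ is free holomorphic in a neighborhood of the origin; (c) $\sup_{k}\big\|\sum_{p=0}^k\sum_{|\alpha|=p}a_\alpha W_\alpha W_\alpha^*\big\|<\infty$, where $g^{-1}=1+\sum_{|\alpha|\ge1}a_\alpha Z_\alpha$ is the inverse power series ($a_{g_0}=1$) and $W_ie_\alpha=\sqrt{b_\alpha/b_{g_i\alpha}}\,e_{g_i\alpha}$ are the weighted left creation operators on $F^2(H_n)$. For a tuple $X$, $C^*(X)$ is the $C^*$-algebra generated by $X_1,\ldots,X_n$ and the identity. A unital $*$-representation $\pi$ of $C^*({\bf W})$ is of Cuntz type if $\sum_{k=0}^\infty\sum_{|\alpha|=k}a_\alpha\pi(W_\alpha)\pi(W_\alpha)^*=0$. *)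

theory Defs
  imports "HOL-Analysis.Analysis"
begin

section \<open>Complex Hilbert spaces\<close>

text \<open>
  The underlying real Hilbert space carries the real part of the complex inner product, so that
  norm, completeness and the operator norm on \<open>'a \<Rightarrow>\<^sub>L 'a\<close> are the library's.  The complex inner
  product is linear in its first argument.
\<close>

class complex_hilbert = real_inner + complete_space +
  fixes scaleC :: "complex \<Rightarrow> 'a \<Rightarrow> 'a"  (infixr \<open>*\<^sub>C\<close> 75)
    and cinner :: "'a \<Rightarrow> 'a \<Rightarrow> complex"
  assumes scaleC_add_right: "c *\<^sub>C (x + y) = c *\<^sub>C x + c *\<^sub>C y"
    and scaleC_add_left: "(c + d) *\<^sub>C x = c *\<^sub>C x + d *\<^sub>C x"
    and scaleC_scaleC: "c *\<^sub>C (d *\<^sub>C x) = (c * d) *\<^sub>C x"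
    and scaleR_scaleC: "r *\<^sub>R x = complex_of_real r *\<^sub>C x"
    and cinner_commute: "cinner x y = cnj (cinner y x)"
    and cinner_add_left: "cinner (x + y) z = cinner x z + cinner y z"
    and cinner_scaleC_left: "cinner (c *\<^sub>C x) y = c * cinner x y"
    and inner_eq_Re_cinner: "inner x y = Re (cinner x y)"

subclass (in complex_hilbert) banach ..

lemma cinner_add_right: "cinner x (y + z) = cinner x y + cinner x z"
  by (metis cinner_add_left cinner_commute complex_cnj_add)

lemma cinner_scaleC_right: "cinner x (c *\<^sub>C y) = cnj c * cinner x y"
  by (metis cinner_scaleC_left cinner_commute complex_cnj_mult)

lemma cinner_self: "cinner x x = complex_of_real ((norm x)\<^sup>2)"
proof -
  have "Im (cinner x x) = 0"
    using arg_cong[OF cinner_commute[of x x], of Im] by simp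
  moreover have "Re (cinner x x) = (norm x)\<^sup>2"
    by (simp add: inner_eq_Re_cinner[symmetric] norm_eq_sqrt_inner)
  ultimately show ?thesis by (simp add: complex_eq_iff)
qed

lemma cinner_zero_left [simp]: "cinner 0 x = 0"
  using cinner_add_left[of 0 0 x] by simp

lemma cinner_zero_right [simp]: "cinner x 0 = 0"
  using cinner_add_right[of x 0 0] by simp

lemma scaleC_one [simp]: "1 *\<^sub>C x = x"
  using scaleR_scaleC[of 1 x] by simp

lemma scaleC_zero_right [simp]: "c *\<^sub>C 0 = 0"
  using scaleC_add_right[of c 0 0] by simp

lemma cinner_minus_left: "cinner (- x) y = - cinner x y"
  using cinner_add_left[of x "- x" y] by (simp add: add_eq_0_iff)

lemma cinner_minus_right: "cinner x (- y) = - cinner x y"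
  using cinner_add_right[of x y "- y"] by (simp add: add_eq_0_iff)

lemma cinner_diff_left: "cinner (x - y) z = cinner x z - cinner y z"
  using cinner_add_left[of x "- y" z] by (simp add: cinner_minus_left)

lemma cinner_diff_right: "cinner x (y - z) = cinner x y - cinner x z"
  using cinner_add_right[of x y "- z"] by (simp add: cinner_minus_right)

lemma cinner_sum_left: "cinner (sum f A) x = (\<Sum>i\<in>A. cinner (f i) x)"
  by (induction A rule: infinite_finite_induct) (auto simp: cinner_add_left)

lemma cinner_sum_right: "cinner x (sum f A) = (\<Sum>i\<in>A. cinner x (f i))"
  by (induction A rule: infinite_finite_induct) (auto simp: cinner_add_right)

lemma norm_scaleC: "norm (c *\<^sub>C x) = cmod c * norm x"
proof -
  have "complex_of_real ((norm (c *\<^sub>C x))\<^sup>2) = (c * cnj c) * complex_of_real ((norm x)\<^sup>2)"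
    unfolding cinner_self[symmetric] by (simp add: cinner_scaleC_left cinner_scaleC_right)
  also have "\<dots> = complex_of_real ((cmod c * norm x)\<^sup>2)"
    by (simp only: complex_norm_square[symmetric] power_mult_distrib of_real_mult)
  finally have "(norm (c *\<^sub>C x))\<^sup>2 = (cmod c * norm x)\<^sup>2"
    by (simp only: of_real_eq_iff)
  thus ?thesis
    by (metis abs_of_nonneg mult_nonneg_nonneg norm_ge_zero power2_eq_iff_nonneg)
qed

lemma cinner_eqI: "(\<And>z. cinner x z = cinner y z) \<Longrightarrow> x = y"
proof -
  assume a: "\<And>z. cinner x z = cinner y z"
  have "cinner (x - y) (x - y) = 0" by (simp add: cinner_diff_left a)
  thus "x = y" by (simp add: cinner_self)
qed

lemma Cauchy_Schwarz_cinner: "cmod (cinner x y) \<le> norm x * norm y"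
proof (cases "cinner x y = 0")
  case False
  define u where "u = cnj (sgn (cinner x y))"
  have u: "cmod u = 1" using False by (simp add: u_def norm_sgn)
  have "cmod (cinner x y) = Re (u * cinner x y)"
  proof -
    have "u * cinner x y = cnj (cinner x y) * cinner x y / cmod (cinner x y)"
      by (simp add: u_def sgn_eq)
    also have "\<dots> = complex_of_real ((cmod (cinner x y))\<^sup>2 / cmod (cinner x y))"
      by (simp only: mult.commute[of "cnj _"] complex_norm_square[symmetric] of_real_divide of_real_power)
    also have "\<dots> = complex_of_real (cmod (cinner x y))" by (simp add: power2_eq_square)
    finally show ?thesis by simp
  qed
  also have "\<dots> = inner (u *\<^sub>C x) y" by (simp add: inner_eq_Re_cinner cinner_scaleC_left)
  also have "\<dots> \<le> norm (u *\<^sub>C x) * norm y" by (rule norm_cauchy_schwarz)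
  finally show ?thesis using u by (simp add: norm_scaleC)
qed simp


subsection \<open>The space of square-summable families\<close>

typedef 'i ell2 = "{x :: 'i \<Rightarrow> complex. (\<lambda>i. (cmod (x i))\<^sup>2) summable_on UNIV}"
  morphisms coord Abs_ell2
  by (rule exI[of _ "\<lambda>_. 0"]) simp

setup_lifting type_definition_ell2

lemma coord_summable: "(\<lambda>i. (cmod (coord x i))\<^sup>2) summable_on UNIV"
  using coord[of x] by simp

lemma ell2_eqI: "(\<And>i. coord x i = coord y i) \<Longrightarrow> x = y"
  by (simp add: coord_inject[symmetric] fun_eq_iff)

lemma cmod_add_sq: "(cmod (a + b))\<^sup>2 \<le> 2 * (cmod a)\<^sup>2 + 2 * (cmod b)\<^sup>2"
proof -
  have "(cmod (a + b))\<^sup>2 \<le> (cmod a + cmod b)\<^sup>2"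
    by (intro power_mono norm_triangle_ineq) auto
  also have "\<dots> \<le> 2 * (cmod a)\<^sup>2 + 2 * (cmod b)\<^sup>2"
    using sum_squares_bound[of "cmod a" "cmod b"] by (simp add: power2_sum)
  finally show ?thesis .
qed

lemma sq_summable_add:
  assumes "(\<lambda>i. (cmod (x i))\<^sup>2) summable_on A" "(\<lambda>i. (cmod (y i))\<^sup>2) summable_on A"
  shows "(\<lambda>i. (cmod (x i + y i))\<^sup>2) summable_on A"
proof (rule summable_on_comparison_test)
  show "(\<lambda>i. 2 * (cmod (x i))\<^sup>2 + 2 * (cmod (y i))\<^sup>2) summable_on A"
    by (intro summable_on_add summable_on_cmult_right assms)
qed (auto simp: cmod_add_sq)

lemma sq_summable_cmult:
  assumes "(\<lambda>i. (cmod (x i))\<^sup>2) summable_on A"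
  shows "(\<lambda>i. (cmod (c * x i))\<^sup>2) summable_on A"
  by (simp add: norm_mult power_mult_distrib summable_on_cmult_right assms)

lemma sq_summable_product:
  assumes "(\<lambda>i. (cmod (x i))\<^sup>2) summable_on A" "(\<lambda>i. (cmod (y i))\<^sup>2) summable_on A"
  shows "(\<lambda>i. x i * cnj (y i)) summable_on A"
proof (rule abs_summable_summable, rule summable_on_comparison_test)
  show "(\<lambda>i. (cmod (x i))\<^sup>2 + (cmod (y i))\<^sup>2) summable_on A"
    by (intro summable_on_add assms)
  fix i
  have "2 * (cmod (x i) * cmod (y i)) \<le> (cmod (x i))\<^sup>2 + (cmod (y i))\<^sup>2"
    using sum_squares_bound[of "cmod (x i)" "cmod (y i)"] by simp
  moreover have "0 \<le> cmod (x i) * cmod (y i)" by simp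
  ultimately show "norm (x i * cnj (y i)) \<le> (cmod (x i))\<^sup>2 + (cmod (y i))\<^sup>2"
    unfolding norm_mult complex_mod_cnj by linarith
qed simp

instantiation ell2 :: (type) real_inner
begin

lift_definition zero_ell2 :: "'a ell2" is "\<lambda>_. 0" by simp
lift_definition plus_ell2 :: "'a ell2 \<Rightarrow> 'a ell2 \<Rightarrow> 'a ell2" is "\<lambda>x y i. x i + y i"
  by (rule sq_summable_add)
lift_definition uminus_ell2 :: "'a ell2 \<Rightarrow> 'a ell2" is "\<lambda>x i. - x i" by simp
lift_definition minus_ell2 :: "'a ell2 \<Rightarrow> 'a ell2 \<Rightarrow> 'a ell2" is "\<lambda>x y i. x i - y i"
  using sq_summable_add[of _ UNIV "\<lambda>i. - _ i"] by simp
lift_definition scaleR_ell2 :: "real \<Rightarrow> 'a ell2 \<Rightarrow> 'a ell2" is "\<lambda>r x i. complex_of_real r * x i"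
  by (rule sq_summable_cmult)

definition inner_ell2 :: "'a ell2 \<Rightarrow> 'a ell2 \<Rightarrow> real" where
  "inner_ell2 x y = Re (\<Sum>\<^sub>\<infinity>i. coord x i * cnj (coord y i))"

definition norm_ell2 :: "'a ell2 \<Rightarrow> real" where "norm_ell2 x = sqrt (inner x x)"
definition dist_ell2 :: "'a ell2 \<Rightarrow> 'a ell2 \<Rightarrow> real" where "dist_ell2 x y = norm (x - y)"
definition sgn_ell2 :: "'a ell2 \<Rightarrow> 'a ell2" where "sgn_ell2 x = inverse (norm x) *\<^sub>R x"
definition uniformity_ell2 :: "('a ell2 \<times> 'a ell2) filter" where
  "uniformity_ell2 = (INF e\<in>{0<..}. principal {(x, y). dist x y < e})"
definition open_ell2 :: "'a ell2 set \<Rightarrow> bool" where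
  "open_ell2 U = (\<forall>x\<in>U. \<forall>\<^sub>F (x', y) in uniformity. x' = x \<longrightarrow> y \<in> U)"

lemma inner_ell2_self: "inner (x :: 'a ell2) x = (\<Sum>\<^sub>\<infinity>i. (cmod (coord x i))\<^sup>2)"
proof -
  have "(\<Sum>\<^sub>\<infinity>i. coord x i * cnj (coord x i)) = (\<Sum>\<^sub>\<infinity>i. complex_of_real ((cmod (coord x i))\<^sup>2))"
    by (intro infsum_cong) (simp only: complex_norm_square)
  also have "Re \<dots> = (\<Sum>\<^sub>\<infinity>i. (cmod (coord x i))\<^sup>2)"
    by (subst infsum_Re[symmetric])
      (auto intro!: summable_on_of_real coord_summable simp del: of_real_power)
  finally show ?thesis by (simp add: inner_ell2_def)
qed

instance
proof
  note sm = sq_summable_product[OF coord_summable coord_summable]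
  fix x y z :: "'a ell2" and r s :: real
  show "x + y + z = x + (y + z)" "x + y = y + x" "0 + x = x" "- x + x = 0" "x - y = x + - y"
    by (transfer; auto simp: algebra_simps)+
  show "r *\<^sub>R (x + y) = r *\<^sub>R x + r *\<^sub>R y" "(r + s) *\<^sub>R x = r *\<^sub>R x + s *\<^sub>R x"
    "r *\<^sub>R s *\<^sub>R x = (r * s) *\<^sub>R x" "1 *\<^sub>R x = x"
    by (transfer; auto simp: algebra_simps)+
  have "(\<Sum>\<^sub>\<infinity>i. coord x i * cnj (coord y i)) = cnj (\<Sum>\<^sub>\<infinity>i. coord y i * cnj (coord x i))"
    by (simp add: infsum_cnj[symmetric] mult.commute del: infsum_cnj)
  thus "inner x y = inner y x" by (simp add: inner_ell2_def)
  show "inner (x + y) z = inner x z + inner y z"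
    by (simp add: inner_ell2_def plus_ell2.rep_eq distrib_right infsum_add sm)
  show "inner (r *\<^sub>R x) y = r * inner x y"
    by (simp add: inner_ell2_def scaleR_ell2.rep_eq mult.assoc infsum_cmult_right sm)
  show "0 \<le> inner x x" by (simp add: inner_ell2_self infsum_nonneg)
  show "inner x x = 0 \<longleftrightarrow> x = 0"
  proof
    assume "inner x x = 0"
    hence "(cmod (coord x i))\<^sup>2 = 0" for i
      unfolding inner_ell2_self by (intro nonneg_infsum_le_0D[where A = UNIV]) (auto intro: coord_summable)
    thus "x = 0" by (intro ell2_eqI) (simp add: zero_ell2.rep_eq)
  qed (simp add: inner_ell2_self zero_ell2.rep_eq)
qed (simp_all add: norm_ell2_def dist_ell2_def sgn_ell2_def uniformity_ell2_def open_ell2_def)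

end

lemma norm_ell2_sq: "(norm x)\<^sup>2 = (\<Sum>\<^sub>\<infinity>i. (cmod (coord x i))\<^sup>2)" for x :: "'i ell2"
  using power2_norm_eq_inner[of x] by (simp only: inner_ell2_self)

lemma ell2_partial_sum_le: "finite F \<Longrightarrow> (\<Sum>i\<in>F. (cmod (coord x i))\<^sup>2) \<le> (norm x)\<^sup>2"
  unfolding norm_ell2_sq by (intro finite_sum_le_infsum coord_summable) auto

lemma coord_le_norm: "cmod (coord x i) \<le> norm x"
  using ell2_partial_sum_le[of "{i}" x] by (simp add: power2_le_iff_abs_le)

lemma ell2_bounded_partial_sums:
  assumes "0 \<le> B" "\<And>F. finite F \<Longrightarrow> (\<Sum>i\<in>F. (cmod (f i))\<^sup>2) \<le> B\<^sup>2"
  shows "coord (Abs_ell2 f) = f" and "norm (Abs_ell2 f) \<le> B"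
proof -
  have "(\<lambda>i. (cmod (f i))\<^sup>2) summable_on UNIV"
    by (rule nonneg_bdd_above_summable_on) (auto intro!: bdd_aboveI2[where M = "B\<^sup>2"] assms)
  thus c: "coord (Abs_ell2 f) = f" by (intro Abs_ell2_inverse) simp
  have "(norm (Abs_ell2 f))\<^sup>2 \<le> B\<^sup>2"
    unfolding norm_ell2_sq
    by (rule infsum_le_finite_sums[OF coord_summable]) (simp add: c assms)
  thus "norm (Abs_ell2 f) \<le> B" using assms(1) by (rule power2_le_imp_le)
qed

instance ell2 :: (type) complete_space
proof
  fix X :: "nat \<Rightarrow> 'a ell2"
  assume X: "Cauchy X"
  have coord_diff: "coord (x - y) i = coord x i - coord y i" for x y :: "'a ell2" and i
    by (simp add: minus_ell2.rep_eq)
  have "Cauchy (\<lambda>n. coord (X n) i)" for i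
  proof (rule CauchyI)
    fix e :: real assume "e > 0"
    then obtain N where "\<forall>m\<ge>N. \<forall>n\<ge>N. norm (X m - X n) < e" using CauchyD[OF X] by blast
    thus "\<exists>N. \<forall>m\<ge>N. \<forall>n\<ge>N. norm (coord (X m) i - coord (X n) i) < e"
      unfolding coord_diff[symmetric] by (meson coord_le_norm le_less_trans)
  qed
  hence "\<forall>i. \<exists>l. (\<lambda>n. coord (X n) i) \<longlonglongrightarrow> l" by (simp add: Cauchy_convergent_iff convergent_def)
  then obtain f where f: "\<And>i. (\<lambda>n. coord (X n) i) \<longlonglongrightarrow> f i" by metis
  have tail: "(\<Sum>i\<in>F. (cmod (f i - coord (X n) i))\<^sup>2) \<le> e\<^sup>2"
    if e: "\<forall>m\<ge>N. \<forall>n\<ge>N. norm (X m - X n) < e" and n: "n \<ge> N" and F: "finite F" for e N n F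
  proof (rule tendsto_upperbound)
    show "(\<lambda>m. \<Sum>i\<in>F. (cmod (coord (X m) i - coord (X n) i))\<^sup>2)
        \<longlonglongrightarrow> (\<Sum>i\<in>F. (cmod (f i - coord (X n) i))\<^sup>2)"
      by (intro tendsto_intros f)
    have "(\<Sum>i\<in>F. (cmod (coord (X m) i - coord (X n) i))\<^sup>2) \<le> e\<^sup>2" if "m \<ge> N" for m
    proof -
      have "(\<Sum>i\<in>F. (cmod (coord (X m) i - coord (X n) i))\<^sup>2) \<le> (norm (X m - X n))\<^sup>2"
        using ell2_partial_sum_le[OF F, of "X m - X n"] by (simp add: coord_diff)
      also have "\<dots> \<le> e\<^sup>2"
        using e n that less_imp_le by (intro power_mono) auto
      finally show ?thesis .
    qed
    thus "\<forall>\<^sub>F m in sequentially. (\<Sum>i\<in>F. (cmod (coord (X m) i - coord (X n) i))\<^sup>2) \<le> e\<^sup>2"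
      by (auto simp: eventually_sequentially)
  qed simp
  have close: "coord (X n + Abs_ell2 (\<lambda>i. f i - coord (X n) i)) = f \<and>
      norm (Abs_ell2 (\<lambda>i. f i - coord (X n) i)) \<le> e"
    if "\<forall>m\<ge>N. \<forall>n\<ge>N. norm (X m - X n) < e" "n \<ge> N" "e > 0" for e N n
    using ell2_bounded_partial_sums[of e "\<lambda>i. f i - coord (X n) i"] tail[OF that(1,2)] that(3)
    by (auto simp: plus_ell2.rep_eq)
  have "X \<longlonglongrightarrow> Abs_ell2 f"
  proof (rule LIMSEQ_I)
    fix r :: real assume r: "r > 0"
    then obtain N where N: "\<forall>m\<ge>N. \<forall>n\<ge>N. norm (X m - X n) < r / 2"
      using CauchyD[OF X, of "r / 2"] by auto
    have "norm (X n - Abs_ell2 f) < r" if "n \<ge> N" for n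
    proof -
      have c: "coord (X n + Abs_ell2 (\<lambda>i. f i - coord (X n) i)) = f"
          "norm (Abs_ell2 (\<lambda>i. f i - coord (X n) i)) \<le> r / 2"
        using close[OF N that] r by auto
      have "Abs_ell2 f = X n + Abs_ell2 (\<lambda>i. f i - coord (X n) i)"
        by (metis c(1) coord_inverse)
      thus ?thesis using c(2) r by simp
    qed
    thus "\<exists>no. \<forall>n\<ge>no. norm (X n - Abs_ell2 f) < r" by blast
  qed
  thus "convergent X" by (rule convergentI)
qed

instantiation ell2 :: (type) complex_hilbert
begin

lift_definition scaleC_ell2 :: "complex \<Rightarrow> 'a ell2 \<Rightarrow> 'a ell2" is "\<lambda>c x i. c * x i"
  by (rule sq_summable_cmult)

definition cinner_ell2 :: "'a ell2 \<Rightarrow> 'a ell2 \<Rightarrow> complex" where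
  "cinner_ell2 x y = (\<Sum>\<^sub>\<infinity>i. coord x i * cnj (coord y i))"

instance
proof
  note sm = sq_summable_product[OF coord_summable coord_summable]
  fix x y z :: "'a ell2" and c d :: complex and r :: real
  show "c *\<^sub>C (x + y) = c *\<^sub>C x + c *\<^sub>C y" "(c + d) *\<^sub>C x = c *\<^sub>C x + d *\<^sub>C x"
    "c *\<^sub>C d *\<^sub>C x = (c * d) *\<^sub>C x" "r *\<^sub>R x = complex_of_real r *\<^sub>C x"
    by (transfer; auto simp: algebra_simps)+
  show "cinner x y = cnj (cinner y x)"
    by (simp add: cinner_ell2_def infsum_cnj[symmetric] mult.commute del: infsum_cnj)
  show "cinner (x + y) z = cinner x z + cinner y z"
    by (simp add: cinner_ell2_def plus_ell2.rep_eq distrib_right infsum_add sm)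
  show "cinner (c *\<^sub>C x) y = c * cinner x y"
    by (simp add: cinner_ell2_def scaleC_ell2.rep_eq mult.assoc infsum_cmult_right sm)
  show "inner x y = Re (cinner x y)" by (simp add: inner_ell2_def cinner_ell2_def)
qed

end

lift_definition ell2_basis :: "'i \<Rightarrow> 'i ell2" is "\<lambda>i j. if j = i then 1 else 0"
proof -
  fix i :: 'i
  have "(\<lambda>j. (cmod (if j = i then 1 else 0))\<^sup>2) summable_on {i}" by simp
  thus "(\<lambda>j. (cmod (if j = i then 1 else 0))\<^sup>2) summable_on UNIV"
    by (rule iffD1[OF summable_on_cong_neutral, rotated -1]) auto
qed

lemma cinner_ell2_basis: "cinner x (ell2_basis i) = coord x i"
proof -
  have "cinner x (ell2_basis i) = (\<Sum>\<^sub>\<infinity>j\<in>{i}. coord x j)"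
    unfolding cinner_ell2_def by (rule infsum_cong_neutral) (auto simp: ell2_basis.rep_eq)
  thus ?thesis by simp
qed

lemma ell2_basis_orthonormal: "cinner (ell2_basis i) (ell2_basis j) = (if i = j then 1 else 0)"
  by (auto simp: cinner_ell2_basis ell2_basis.rep_eq)

lemma ell2_basis_total: "(\<And>i. cinner x (ell2_basis i) = 0) \<Longrightarrow> x = 0"
  by (rule ell2_eqI) (simp add: cinner_ell2_basis zero_ell2.rep_eq)


section \<open>Bounded operators and \<open>C\<^sup>*\<close>-algebras\<close>

definition clinear_op :: "('a::complex_hilbert \<Rightarrow>\<^sub>L 'b::complex_hilbert) \<Rightarrow> bool" where
  "clinear_op T \<longleftrightarrow> (\<forall>c x. T (c *\<^sub>C x) = c *\<^sub>C T x)"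

definition adj :: "('a::complex_hilbert \<Rightarrow>\<^sub>L 'b::complex_hilbert) \<Rightarrow> ('b \<Rightarrow>\<^sub>L 'a)" where
  "adj T = (THE S :: 'b \<Rightarrow>\<^sub>L 'a. \<forall>x y. cinner (T x) y = cinner x (S y))"

definition scale_op :: "complex \<Rightarrow> ('a::complex_hilbert \<Rightarrow>\<^sub>L 'b::complex_hilbert) \<Rightarrow> ('a \<Rightarrow>\<^sub>L 'b)" where
  "scale_op c T = Blinfun (\<lambda>x. c *\<^sub>C T x)"

lemma scale_op_apply [simp]: "scale_op c T x = c *\<^sub>C T x"
proof -
  have "bounded_linear (\<lambda>x. c *\<^sub>C T x)"
  proof (rule bounded_linear_intro[where K = "cmod c * norm T"])
    fix x y r
    show "c *\<^sub>C T (x + y) = c *\<^sub>C T x + c *\<^sub>C T y" by (simp add: blinfun.add_right scaleC_add_right)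
    show "c *\<^sub>C T (r *\<^sub>R x) = r *\<^sub>R c *\<^sub>C T x"
      by (simp only: blinfun.scaleR_right) (simp add: scaleR_scaleC scaleC_scaleC mult.commute)
    show "norm (c *\<^sub>C T x) \<le> norm x * (cmod c * norm T)"
      using mult_left_mono[OF norm_blinfun[of T x], of "cmod c"]
      by (simp add: norm_scaleC mult_ac)
  qed
  thus ?thesis by (simp add: scale_op_def bounded_linear_Blinfun_apply)
qed


lemma adj_eqI:
  fixes T :: "'a::complex_hilbert \<Rightarrow>\<^sub>L 'b::complex_hilbert" and S :: "'b \<Rightarrow>\<^sub>L 'a"
  assumes "\<And>x y. cinner (T x) y = cinner x (S y)"
  shows "adj T = S"
  unfolding adj_def
proof (rule the_equality)
  fix S' :: "'b \<Rightarrow>\<^sub>L 'a"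
  assume "\<forall>x y. cinner (T x) y = cinner x (S' y)"
  hence "cinner (S' y) x = cinner (S y) x" for x y
    using assms by (metis cinner_commute)
  thus "S' = S" by (intro blinfun_eqI cinner_eqI)
qed (use assms in blast)

lemma Riesz_real:
  fixes f :: "'a::{real_inner, complete_space} \<Rightarrow> real"
  assumes f: "bounded_linear f"
  shows "\<exists>y. \<forall>x. f x = inner x y"
proof -
  interpret f: bounded_linear f by (rule f)
  define J where "J x = (norm x)\<^sup>2 - 2 * f x" for x
  obtain M where M: "\<And>x. norm (f x) \<le> norm x * M" using f.bounded by blast
  have J_ge: "J x \<ge> - M\<^sup>2" for x
  proof -
    have "f x \<le> norm x * M" using M[of x] by simp
    moreover have "0 \<le> (norm x - M)\<^sup>2" by simp
    ultimately show ?thesis by (simp add: J_def power2_diff)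
  qed
  hence bdd: "bdd_below (range J)" by (intro bdd_belowI2)
  define I where "I = Inf (range J)"
  have I_le: "I \<le> J x" for x unfolding I_def by (rule cInf_lower[OF _ bdd]) simp
  have "\<exists>x. J x < I + 1 / real (Suc n)" for n
    using cInf_lessD[of "range J" "I + 1 / real (Suc n)"] by (auto simp: I_def)
  then obtain x where x: "\<And>n. J (x n) < I + 1 / real (Suc n)" by metis
  have par: "(norm (u - v))\<^sup>2 = 2 * J u + 2 * J v - 4 * J ((1/2) *\<^sub>R (u + v))" for u v
    by (simp add: J_def f.add f.scaleR power2_norm_eq_inner algebra_simps inner_commute)
  have close: "(norm (x m - x n))\<^sup>2 < 2 / real (Suc m) + 2 / real (Suc n)" for m n
    using x[of m] x[of n] I_le[of "(1/2) *\<^sub>R (x m + x n)"] unfolding par by simp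
  have "Cauchy x"
  proof (rule CauchyI)
    fix e :: real assume "e > 0"
    then obtain N where N: "1 / real (Suc N) < e\<^sup>2 / 4"
      using nat_approx_posE[of "e\<^sup>2 / 4"] by auto
    have "norm (x m - x n) < e" if "m \<ge> N" "n \<ge> N" for m n
    proof -
      have "1 / real (Suc m) \<le> 1 / real (Suc N)" "1 / real (Suc n) \<le> 1 / real (Suc N)"
        using that by (auto simp: field_simps)
      hence "(norm (x m - x n))\<^sup>2 < e\<^sup>2" using close[of m n] N by simp
      thus ?thesis using \<open>e > 0\<close> by (simp add: power_less_imp_less_base)
    qed
    thus "\<exists>N. \<forall>m\<ge>N. \<forall>n\<ge>N. norm (x m - x n) < e" by blast
  qed
  then obtain y where y: "x \<longlonglongrightarrow> y" by (auto simp: Cauchy_convergent_iff convergent_def)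
  have "(\<lambda>n. J (x n)) \<longlonglongrightarrow> J y"
    unfolding J_def by (intro tendsto_intros f.tendsto y)
  moreover have "(\<lambda>n. I + 1 / real (Suc n)) \<longlonglongrightarrow> I + 0"
    by (intro tendsto_intros LIMSEQ_Suc[OF lim_1_over_n])
  ultimately have "J y \<le> I + 0"
    using x by (intro LIMSEQ_le[of "\<lambda>n. J (x n)"]) (auto intro: less_imp_le)
  hence Jy: "J y \<le> J z" for z using I_le[of z] by simp
  have "f z = inner z y" for z
  proof (cases "z = 0")
    case False
    define d where "d = inner z y - f z"
    define t where "t = - d / (norm z)\<^sup>2"
    have "J (y + t *\<^sub>R z) = J y + (t\<^sup>2 * (norm z)\<^sup>2 + 2 * t * d)"
      unfolding J_def d_def power2_norm_eq_inner
      by (simp add: f.add f.scaleR algebra_simps inner_commute power2_eq_square)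
    also have "t\<^sup>2 * (norm z)\<^sup>2 + 2 * t * d = - d\<^sup>2 / (norm z)\<^sup>2"
      using False by (simp add: t_def field_simps power2_eq_square)
    finally have "d\<^sup>2 / (norm z)\<^sup>2 \<le> 0" using Jy[of "y + t *\<^sub>R z"] by simp
    hence "d\<^sup>2 \<le> 0" using False by (simp add: divide_le_0_iff)
    thus ?thesis by (simp add: d_def)
  qed (simp add: f.zero)
  thus ?thesis by blast
qed

lemma cinner_adj:
  fixes T :: "'a::complex_hilbert \<Rightarrow>\<^sub>L 'b::complex_hilbert"
  assumes T: "clinear_op T"
  shows "cinner (T x) y = cinner x (adj T y)"
proof -
  have "\<exists>w. \<forall>x. inner (T x) y = inner x w" for y
    by (intro Riesz_real bounded_linear_inner_left_comp blinfun.bounded_linear_right)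
  then obtain S where S: "\<And>x y. inner (T x) y = inner x (S y)" by metis
  have cS: "cinner (T x) y = cinner x (S y)" for x y
  proof (rule complex_eqI)
    show "Re (cinner (T x) y) = Re (cinner x (S y))"
      using S by (simp add: inner_eq_Re_cinner)
    show "Im (cinner (T x) y) = Im (cinner x (S y))"
      using S[of "\<i> *\<^sub>C x" y] T by (simp add: inner_eq_Re_cinner clinear_op_def cinner_scaleC_left)
  qed
  have "bounded_linear S"
  proof (rule bounded_linear_intro[where K = "norm T"])
    have eqI: "u = v" if "\<And>x. inner x u = inner x v" for u v :: 'a
      using that[of "u - v"] by (metis inner_diff_right inner_eq_zero_iff right_minus_eq)
    fix x y r
    show "S (x + y) = S x + S y" by (rule eqI) (simp add: S[symmetric] inner_add_right)
    show "S (r *\<^sub>R x) = r *\<^sub>R S x" by (rule eqI) (simp add: S[symmetric])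
    have "(norm (S x))\<^sup>2 = inner (T (S x)) x" by (simp add: S power2_norm_eq_inner)
    also have "\<dots> \<le> norm T * norm (S x) * norm x"
      by (rule order_trans[OF norm_cauchy_schwarz]) (intro mult_right_mono norm_blinfun norm_ge_zero)
    finally have "norm (S x) * norm (S x) \<le> norm (S x) * (norm x * norm T)"
      by (simp add: power2_eq_square mult_ac)
    thus "norm (S x) \<le> norm x * norm T"
      by (cases "norm (S x) = 0") (auto simp: mult_le_cancel_left)
  qed
  hence "adj T = Blinfun S" by (intro adj_eqI) (simp add: cS bounded_linear_Blinfun_apply)
  thus ?thesis using \<open>bounded_linear S\<close> by (simp add: cS bounded_linear_Blinfun_apply)
qed

text \<open>
  Operators on \<open>'a \<Rightarrow>\<^sub>L 'a\<close> are only real-linear; the first conjunct singles out \<open>B(H)\<close>.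
\<close>

definition cstar_subalgebra :: "('a::complex_hilbert \<Rightarrow>\<^sub>L 'a) set \<Rightarrow> bool" where
  "cstar_subalgebra A \<longleftrightarrow> (\<forall>T\<in>A. clinear_op T) \<and> 0 \<in> A \<and>
     (\<forall>S\<in>A. \<forall>T\<in>A. S + T \<in> A \<and> S o\<^sub>L T \<in> A) \<and>
     (\<forall>c. \<forall>T\<in>A. scale_op c T \<in> A) \<and> (\<forall>T\<in>A. adj T \<in> A) \<and> closed A"

definition Cstar :: "('n \<Rightarrow> ('a::complex_hilbert \<Rightarrow>\<^sub>L 'a)) \<Rightarrow> ('a \<Rightarrow>\<^sub>L 'a) set" where
  "Cstar X = cstar_subalgebra hull (insert id_blinfun (range X))"

definition star_hom ::
  "('a::complex_hilbert \<Rightarrow>\<^sub>L 'a) set \<Rightarrow> (('a \<Rightarrow>\<^sub>L 'a) \<Rightarrow> ('b::complex_hilbert \<Rightarrow>\<^sub>L 'b)) \<Rightarrow> bool" where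
  "star_hom A \<phi> \<longleftrightarrow>
     (\<forall>S\<in>A. \<forall>T\<in>A. \<phi> (S + T) = \<phi> S + \<phi> T \<and> \<phi> (S o\<^sub>L T) = \<phi> S o\<^sub>L \<phi> T) \<and>
     (\<forall>c. \<forall>T\<in>A. \<phi> (scale_op c T) = scale_op c (\<phi> T)) \<and>
     (\<forall>T\<in>A. \<phi> (adj T) = adj (\<phi> T))"

definition unital_star_rep ::
  "('a::complex_hilbert \<Rightarrow>\<^sub>L 'a) set \<Rightarrow> (('a \<Rightarrow>\<^sub>L 'a) \<Rightarrow> ('b::complex_hilbert \<Rightarrow>\<^sub>L 'b)) \<Rightarrow> bool" where
  "unital_star_rep A \<pi> \<longleftrightarrow> (\<forall>T\<in>A. clinear_op (\<pi> T)) \<and> star_hom A \<pi> \<and> \<pi> id_blinfun = id_blinfun"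

definition star_isomorphic ::
  "('a::complex_hilbert \<Rightarrow>\<^sub>L 'a) set \<Rightarrow> ('b::complex_hilbert \<Rightarrow>\<^sub>L 'b) set \<Rightarrow> bool" where
  "star_isomorphic A B \<longleftrightarrow> (\<exists>\<phi>. star_hom A \<phi> \<and> bij_betw \<phi> A B)"


section \<open>Noncommutative power series\<close>

text \<open>
  The free semigroup on the generators \<open>'n\<close> is \<open>'n list\<close>: \<open>[]\<close> is its identity and
  \<open>i # \<alpha>\<close> is the product of the generator \<open>i\<close> with \<open>\<alpha>\<close>.  A formal power series is its family
  of coefficients.
\<close>

definition word_op :: "('n \<Rightarrow> ('a::complex_hilbert \<Rightarrow>\<^sub>L 'a)) \<Rightarrow> 'n list \<Rightarrow> ('a \<Rightarrow>\<^sub>L 'a)" where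
  "word_op X \<alpha> = foldr (\<lambda>i T. X i o\<^sub>L T) \<alpha> id_blinfun"

definition nc_mult :: "('n list \<Rightarrow> real) \<Rightarrow> ('n list \<Rightarrow> real) \<Rightarrow> 'n list \<Rightarrow> real" where
  "nc_mult p q \<alpha> = (\<Sum>k\<le>length \<alpha>. p (take k \<alpha>) * q (drop k \<alpha>))"

definition nc_one :: "'n list \<Rightarrow> real" where
  "nc_one \<alpha> = (if \<alpha> = [] then 1 else 0)"

definition nc_inverse :: "('n list \<Rightarrow> real) \<Rightarrow> ('n list \<Rightarrow> real) \<Rightarrow> bool" where
  "nc_inverse p q \<longleftrightarrow> nc_mult p q = nc_one \<and> nc_mult q p = nc_one"

text \<open>
  The lemmas \<open>free_holomorphic_summable\<close> and \<open>free_holomorphicI\<close> below show the equivalence with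
  norm convergence of \<open>\<Sum>\<^sub>k \<Sum>\<^bsub>|\<alpha>| = k\<^esub> c\<^sub>\<alpha> X\<^sub>\<alpha>\<close> on a ball of row operators \<open>X\<close>, over
  every Hilbert space.
\<close>

definition free_holomorphic :: "('n::finite list \<Rightarrow> complex) \<Rightarrow> bool" where
  "free_holomorphic c \<longleftrightarrow>
     limsup (\<lambda>k. ereal ((\<Sum>\<alpha> | length \<alpha> = k. (cmod (c \<alpha>))\<^sup>2) powr (1 / (2 * real k)))) < \<infinity>"


section \<open>Weighted left creation operators\<close>

text \<open>
  The full Fock space on an \<open>n\<close>-dimensional space is realised as \<open>\<ell>\<^sup>2\<close> over the words,
  with \<open>ell2_basis \<alpha>\<close> in the role of \<open>e\<^sub>\<alpha>\<close>.
\<close>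

type_synonym 'n fock = "'n list ell2"

definition weighted_left_creation :: "('n list \<Rightarrow> real) \<Rightarrow> 'n \<Rightarrow> ('n fock \<Rightarrow>\<^sub>L 'n fock)" where
  "weighted_left_creation b i = Blinfun (\<lambda>x. Abs_ell2 (\<lambda>\<beta>. case \<beta> of [] \<Rightarrow> 0
     | j # \<alpha> \<Rightarrow> if j = i then complex_of_real (sqrt (b \<alpha> / b (i # \<alpha>))) * coord x \<alpha> else 0))"

text \<open>
  Coefficients are real: admissibility requires those of \<open>g\<close> to be positive, and then
  those of the inverse series are real.
\<close>

definition admissible :: "('n::finite list \<Rightarrow> real) \<Rightarrow> bool" where
  "admissible b \<longleftrightarrow>
     b [] = 1 \<and> (\<forall>\<alpha>. b \<alpha> > 0) \<and> (\<forall>i. bdd_above (range (\<lambda>\<alpha>. b \<alpha> / b (i # \<alpha>)))) \<and>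
     free_holomorphic (\<lambda>\<alpha>. complex_of_real (b \<alpha>)) \<and>
     (let W = weighted_left_creation b in
      \<exists>a. nc_inverse b a \<and>
        bdd_above (range (\<lambda>k. norm (\<Sum>p\<le>k. \<Sum>\<alpha> | length \<alpha> = p.
          a \<alpha> *\<^sub>R (word_op W \<alpha> o\<^sub>L adj (word_op W \<alpha>))))))"

definition Cuntz_type ::
  "('n::finite list \<Rightarrow> real) \<Rightarrow> ('n \<Rightarrow> ('a::complex_hilbert \<Rightarrow>\<^sub>L 'a)) \<Rightarrow>
   (('a \<Rightarrow>\<^sub>L 'a) \<Rightarrow> ('b::complex_hilbert \<Rightarrow>\<^sub>L 'b)) \<Rightarrow> bool" where
  "Cuntz_type a W \<pi> \<longleftrightarrow>
     (\<lambda>k. \<Sum>\<alpha> | length \<alpha> = k. a \<alpha> *\<^sub>R (\<pi> (word_op W \<alpha>) o\<^sub>L adj (\<pi> (word_op W \<alpha>)))) sums 0"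


section \<open>Well-definedness and sanity lemmas\<close>

lemma nc_mult_assoc: "nc_mult (nc_mult p q) r = nc_mult p (nc_mult q r)"
proof
  fix \<alpha> :: "'a list"
  define n where "n = length \<alpha>"
  define t where "t j k = p (take j \<alpha>) * q (take k (drop j \<alpha>)) * r (drop (j + k) \<alpha>)" for j k
  have "nc_mult (nc_mult p q) r \<alpha> = (\<Sum>k\<le>n. \<Sum>j\<le>k. t j (k - j))"
    unfolding nc_mult_def n_def
    by (intro sum.cong refl)
      (auto simp: t_def sum_distrib_right min_absorb1 min_absorb2 drop_take intro!: sum.cong)
  also have "\<dots> = (\<Sum>(k, j)\<in>(SIGMA k:{..n}. {..k}). t j (k - j))"
    by (simp add: sum.Sigma)
  also have "\<dots> = (\<Sum>(j, k)\<in>(SIGMA j:{..n}. {..n - j}). t j k)"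
    by (rule sum.reindex_bij_witness[of _ "\<lambda>(j, k). (j + k, j)" "\<lambda>(k, j). (j, k - j)"]) auto
  also have "\<dots> = (\<Sum>j\<le>n. \<Sum>k\<le>n - j. t j k)"
    by (simp add: sum.Sigma)
  also have "\<dots> = nc_mult p (nc_mult q r) \<alpha>"
    unfolding nc_mult_def n_def
    by (intro sum.cong refl) (simp add: t_def sum_distrib_left mult.assoc add.commute)
  finally show "nc_mult (nc_mult p q) r \<alpha> = nc_mult p (nc_mult q r) \<alpha>" .
qed

lemma nc_mult_one_left: "nc_mult nc_one p = p"
proof
  fix \<alpha> :: "'a list"
  have "nc_mult nc_one p \<alpha> = (\<Sum>k\<le>length \<alpha>. if k = 0 then p \<alpha> else 0)"
    unfolding nc_mult_def by (intro sum.cong) (auto simp: nc_one_def)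
  thus "nc_mult nc_one p \<alpha> = p \<alpha>" by simp
qed

lemma nc_mult_one_right: "nc_mult p nc_one = p"
proof
  fix \<alpha> :: "'a list"
  have "nc_mult p nc_one \<alpha> = (\<Sum>k\<le>length \<alpha>. if k = length \<alpha> then p \<alpha> else 0)"
    unfolding nc_mult_def by (intro sum.cong) (auto simp: nc_one_def)
  thus "nc_mult p nc_one \<alpha> = p \<alpha>" by simp
qed

lemma nc_inverse_unique: "nc_inverse p q \<Longrightarrow> nc_inverse p q' \<Longrightarrow> q = q'"
  by (metis nc_inverse_def nc_mult_assoc nc_mult_one_left nc_mult_one_right)

fun nc_rinv :: "('n list \<Rightarrow> real) \<Rightarrow> 'n list \<Rightarrow> real" where
  "nc_rinv p [] = 1"
| "nc_rinv p (i # \<alpha>) = - (\<Sum>k\<le>length \<alpha>. p (i # take k \<alpha>) * nc_rinv p (drop k \<alpha>))"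

lemma nc_mult_rinv:
  assumes "p [] = 1"
  shows "nc_mult p (nc_rinv p) = nc_one"
proof
  fix \<alpha> :: "'a list"
  show "nc_mult p (nc_rinv p) \<alpha> = nc_one \<alpha>"
  proof (cases \<alpha>)
    case (Cons i \<beta>)
    have "nc_mult p (nc_rinv p) \<alpha> =
        p [] * nc_rinv p \<alpha> + (\<Sum>k\<le>length \<beta>. p (i # take k \<beta>) * nc_rinv p (drop k \<beta>))"
      unfolding nc_mult_def Cons by (simp only: length_Cons sum.atMost_Suc_shift) simp
    thus ?thesis using assms Cons by (simp add: nc_one_def)
  qed (simp add: nc_mult_def nc_one_def assms)
qed

lemma nc_mult_rev: "nc_mult (\<lambda>\<alpha>. p (rev \<alpha>)) (\<lambda>\<alpha>. q (rev \<alpha>)) (rev \<alpha>) = nc_mult q p \<alpha>"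
  unfolding nc_mult_def
  by (rule sum.reindex_bij_witness[of _ "\<lambda>k. length \<alpha> - k" "\<lambda>k. length \<alpha> - k"])
    (auto simp: take_rev drop_rev)

lemma nc_inverse_exists:
  assumes "p [] = 1"
  shows "\<exists>!q. nc_inverse p q"
proof -
  define l where "l \<alpha> = nc_rinv (\<lambda>\<alpha>. p (rev \<alpha>)) (rev \<alpha>)" for \<alpha>
  have "nc_mult l p \<alpha> = nc_one \<alpha>" for \<alpha>
  proof -
    have "nc_mult l p \<alpha> = nc_mult (\<lambda>\<alpha>. p (rev \<alpha>)) (nc_rinv (\<lambda>\<alpha>. p (rev \<alpha>))) (rev \<alpha>)"
      by (subst nc_mult_rev[symmetric]) (simp add: l_def)
    thus ?thesis using assms by (simp add: nc_mult_rinv nc_one_def)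
  qed
  hence l: "nc_mult l p = nc_one" by blast
  note r = nc_mult_rinv[of p, OF assms]
  have "l = nc_rinv p" by (metis l r nc_mult_assoc nc_mult_one_left nc_mult_one_right)
  hence "nc_inverse p l" using l r by (simp add: nc_inverse_def)
  thus ?thesis using nc_inverse_unique by blast
qed

lemma cstar_subalgebra_bounded_ops: "cstar_subalgebra {T :: 'a::complex_hilbert \<Rightarrow>\<^sub>L 'a. clinear_op T}"
proof -
  have "clinear_op (adj T)" if "clinear_op T" for T :: "'a \<Rightarrow>\<^sub>L 'a"
    unfolding clinear_op_def
  proof (intro allI cinner_eqI)
    fix c x z
    have a: "cinner (adj T y) z = cinner y (T z)" for y
      by (metis cinner_adj cinner_commute that)
    show "cinner (adj T (c *\<^sub>C x)) z = cinner (c *\<^sub>C adj T x) z"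
      by (simp add: a cinner_scaleC_left)
  qed
  moreover have "closed {T :: 'a \<Rightarrow>\<^sub>L 'a. clinear_op T}"
  proof -
    have "closed {T :: 'a \<Rightarrow>\<^sub>L 'a. T (c *\<^sub>C x) = c *\<^sub>C T x}" for c x
    proof -
      have "{T :: 'a \<Rightarrow>\<^sub>L 'a. T (c *\<^sub>C x) = c *\<^sub>C T x} = 
          {T :: 'a \<Rightarrow>\<^sub>L 'a. T (c *\<^sub>C x) = (scale_op c id_blinfun :: 'a \<Rightarrow>\<^sub>L 'a) (T x)}"
        by simp
      thus ?thesis by (simp only:) (intro closed_Collect_eq continuous_intros)
    qed
    thus ?thesis unfolding clinear_op_def by (intro closed_Collect_all)
  qed
  ultimately show ?thesis
    unfolding cstar_subalgebra_def
    by (simp add: clinear_op_def[abs_def] blinfun.add_left scaleC_add_right scaleC_scaleC mult.commute)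
qed

lemma cstar_subalgebra_Cstar:
  assumes "\<And>i. clinear_op (X i)"
  shows "cstar_subalgebra (Cstar X)" and "id_blinfun \<in> Cstar X" and "X i \<in> Cstar X"
proof -
  have "insert id_blinfun (range X) \<subseteq> {T. clinear_op T}"
    using assms by (auto simp: clinear_op_def)
  hence "Cstar X \<subseteq> {T. clinear_op T}"
    unfolding Cstar_def by (rule hull_minimal) (rule cstar_subalgebra_bounded_ops)
  thus "cstar_subalgebra (Cstar X)"
    unfolding cstar_subalgebra_def Cstar_def hull_def by (auto intro!: closed_Inter)
  show "id_blinfun \<in> Cstar X" "X i \<in> Cstar X"
    using hull_subset[of "insert id_blinfun (range X)" cstar_subalgebra] by (auto simp: Cstar_def)
qed

lemma
  fixes b :: "'n list \<Rightarrow> real"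
  assumes pos: "\<And>\<alpha>. b \<alpha> > 0" and bdd: "bdd_above (range (\<lambda>\<alpha>. b \<alpha> / b (i # \<alpha>)))"
  shows coord_weighted_left_creation: "coord (weighted_left_creation b i x) \<beta> = (case \<beta> of [] \<Rightarrow> 0
      | j # \<alpha> \<Rightarrow> if j = i then complex_of_real (sqrt (b \<alpha> / b (i # \<alpha>))) * coord x \<alpha> else 0)"
    and clinear_weighted_left_creation: "clinear_op (weighted_left_creation b i)"
    and weighted_left_creation_basis: "weighted_left_creation b i (ell2_basis \<alpha>) =
      sqrt (b \<alpha> / b (i # \<alpha>)) *\<^sub>R ell2_basis (i # \<alpha>)"
proof -
  define w where "w \<alpha> = complex_of_real (sqrt (b \<alpha> / b (i # \<alpha>)))" for \<alpha>
  define f where "f x \<beta> = (case \<beta> of [] \<Rightarrow> 0 | j # \<alpha> \<Rightarrow> if j = i then w \<alpha> * coord x \<alpha> else 0)"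
    for x :: "'n fock" and \<beta>
  obtain B where B: "\<And>\<alpha>. b \<alpha> / b (i # \<alpha>) \<le> B" using bdd by (auto simp: bdd_above_def)
  have ratio: "0 \<le> b \<alpha> / b (i # \<alpha>)" for \<alpha> using pos less_imp_le by (intro divide_nonneg_nonneg) auto
  have B0: "0 \<le> B" using ratio[of "[]"] B[of "[]"] by simp
  have w: "(cmod (w \<alpha>))\<^sup>2 \<le> B" for \<alpha> using B[of \<alpha>] ratio[of \<alpha>] by (simp add: w_def del: real_sqrt_divide)
  have sums: "(\<Sum>\<beta>\<in>F. (cmod (f x \<beta>))\<^sup>2) \<le> (sqrt B * norm x)\<^sup>2" if F: "finite F" for x F
  proof -
    define G where "G = {\<alpha>. i # \<alpha> \<in> F}"
    have G: "finite G" unfolding G_def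
      using finite_vimageI[OF F, of "(#) i"] by (simp add: vimage_def)
    have "(\<Sum>\<beta>\<in>F. (cmod (f x \<beta>))\<^sup>2) = (\<Sum>\<beta>\<in>(#) i ` G. (cmod (f x \<beta>))\<^sup>2)"
      by (rule sum.mono_neutral_right[OF F]) (auto simp: G_def f_def split: list.splits)
    also have "\<dots> = (\<Sum>\<alpha>\<in>G. (cmod (w \<alpha>))\<^sup>2 * (cmod (coord x \<alpha>))\<^sup>2)"
      by (subst sum.reindex) (auto simp: f_def norm_mult power_mult_distrib)
    also have "\<dots> \<le> (\<Sum>\<alpha>\<in>G. B * (cmod (coord x \<alpha>))\<^sup>2)"
      by (intro sum_mono mult_right_mono w) auto
    also have "\<dots> \<le> B * (norm x)\<^sup>2"
      unfolding sum_distrib_left[symmetric] by (intro mult_left_mono ell2_partial_sum_le G B0)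
    finally show ?thesis using B0 by (simp add: power_mult_distrib)
  qed
  have c: "coord (Abs_ell2 (f x)) = f x" and n: "norm (Abs_ell2 (f x)) \<le> sqrt B * norm x" for x
    using ell2_bounded_partial_sums[of "sqrt B * norm x" "f x"] sums B0 by auto
  have bl: "bounded_linear (\<lambda>x. Abs_ell2 (f x))"
  proof (rule bounded_linear_intro[where K = "sqrt B"])
    show "Abs_ell2 (f (x + y)) = Abs_ell2 (f x) + Abs_ell2 (f y)" for x y
      by (rule ell2_eqI)
        (auto simp: c plus_ell2.rep_eq f_def distrib_left split: list.splits)
    show "Abs_ell2 (f (r *\<^sub>R x)) = r *\<^sub>R Abs_ell2 (f x)" for r x
      by (rule ell2_eqI) (auto simp: c scaleR_ell2.rep_eq f_def split: list.splits)
  qed (use n in \<open>simp add: mult.commute\<close>)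
  have "weighted_left_creation b i = Blinfun (\<lambda>x. Abs_ell2 (f x))"
    unfolding weighted_left_creation_def f_def w_def ..
  hence W: "coord (weighted_left_creation b i x) = f x" for x
    by (simp add: bounded_linear_Blinfun_apply[OF bl] c)
  show "coord (weighted_left_creation b i x) \<beta> = (case \<beta> of [] \<Rightarrow> 0
      | j # \<alpha> \<Rightarrow> if j = i then complex_of_real (sqrt (b \<alpha> / b (i # \<alpha>))) * coord x \<alpha> else 0)"
    unfolding W f_def w_def ..
  show "clinear_op (weighted_left_creation b i)"
    unfolding clinear_op_def
    by (intro allI ell2_eqI) (auto simp: W scaleC_ell2.rep_eq f_def split: list.splits)
  show "weighted_left_creation b i (ell2_basis \<alpha>) =
      sqrt (b \<alpha> / b (i # \<alpha>)) *\<^sub>R ell2_basis (i # \<alpha>)"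
    by (rule ell2_eqI)
      (auto simp: W scaleR_ell2.rep_eq ell2_basis.rep_eq f_def w_def split: list.splits)
qed

lemma finite_words [simp]: "finite {\<alpha> :: 'n::finite list. length \<alpha> = k}"
  using finite_lists_length_eq[of "UNIV :: 'n set" k] by simp

lemma sum_words_Suc:
  fixes f :: "'n::finite list \<Rightarrow> 'b::comm_monoid_add"
  shows "(\<Sum>\<alpha> | length \<alpha> = Suc k. f \<alpha>) = (\<Sum>i\<in>UNIV. \<Sum>\<alpha> | length \<alpha> = k. f (i # \<alpha>))"
proof -
  have "(\<Sum>\<alpha> | length \<alpha> = Suc k. f \<alpha>) =
      (\<Sum>(i, \<alpha>)\<in>UNIV \<times> {\<alpha>. length \<alpha> = k}. f (i # \<alpha>))"
    by (rule sum.reindex_bij_witness[of _ "\<lambda>(i, \<alpha>). i # \<alpha>" "\<lambda>\<alpha>. (hd \<alpha>, tl \<alpha>)"])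
      (auto simp: length_Suc_conv)
  thus ?thesis by (simp add: sum.cartesian_product)
qed

lemma word_op_simps [simp]: "word_op X [] = id_blinfun" "word_op X (i # \<alpha>) = X i o\<^sub>L word_op X \<alpha>"
  by (simp_all add: word_op_def)

lemma clinear_word_op:
  assumes "\<And>i. clinear_op (X i)" shows "clinear_op (word_op X \<alpha>)"
  using assms by (induction \<alpha>) (auto simp: clinear_op_def)

lemma adj_compose:
  assumes "clinear_op S" "clinear_op T"
  shows "adj (S o\<^sub>L T) = adj T o\<^sub>L adj S"
  by (rule adj_eqI) (simp add: cinner_adj[OF assms(1)] cinner_adj[OF assms(2)])

lemma row_adj_bound:
  fixes X :: "'n::finite \<Rightarrow> ('a::complex_hilbert \<Rightarrow>\<^sub>L 'a)"
  assumes lin: "\<And>i. clinear_op (X i)"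
  shows "(\<Sum>\<alpha> | length \<alpha> = k. (norm (adj (word_op X \<alpha>) y))\<^sup>2)
    \<le> norm (\<Sum>i\<in>UNIV. X i o\<^sub>L adj (X i)) ^ k * (norm y)\<^sup>2"
proof (induction k arbitrary: y)
  case 0
  have "adj (id_blinfun :: 'a \<Rightarrow>\<^sub>L 'a) = id_blinfun" by (rule adj_eqI) simp
  thus ?case by simp
next
  case (Suc k)
  let ?R = "\<Sum>i\<in>UNIV. X i o\<^sub>L adj (X i)"
  have "(\<Sum>\<alpha> | length \<alpha> = Suc k. (norm (adj (word_op X \<alpha>) y))\<^sup>2)
      = (\<Sum>i\<in>UNIV. \<Sum>\<alpha> | length \<alpha> = k. (norm (adj (word_op X \<alpha>) (adj (X i) y)))\<^sup>2)"
    by (simp add: sum_words_Suc adj_compose lin clinear_word_op)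
  also have "\<dots> \<le> (\<Sum>i\<in>UNIV. norm ?R ^ k * (norm (adj (X i) y))\<^sup>2)"
    by (intro sum_mono Suc)
  also have "\<dots> = norm ?R ^ k * (\<Sum>i\<in>UNIV. (norm (adj (X i) y))\<^sup>2)"
    by (simp add: sum_distrib_left)
  also have "\<dots> \<le> norm ?R ^ k * (norm ?R * (norm y)\<^sup>2)"
  proof (rule mult_left_mono)
    have "(\<Sum>i\<in>UNIV. (norm (adj (X i) y))\<^sup>2) = inner (?R y) y"
      by (simp add: blinfun.sum_left inner_eq_Re_cinner cinner_sum_left cinner_adj[OF lin] cinner_self)
    also have "\<dots> \<le> norm ?R * norm y * norm y"
      by (rule order_trans[OF norm_cauchy_schwarz]) (intro mult_right_mono norm_blinfun norm_ge_zero)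
    finally show "(\<Sum>i\<in>UNIV. (norm (adj (X i) y))\<^sup>2) \<le> norm ?R * (norm y)\<^sup>2"
      by (simp add: power2_eq_square mult_ac)
  qed simp
  finally show ?case
    by (simp add: mult_ac)
qed

lemma norm_homogeneous_le:
  fixes X :: "'n::finite \<Rightarrow> ('a::complex_hilbert \<Rightarrow>\<^sub>L 'a)"
  assumes lin: "\<And>i. clinear_op (X i)"
  shows "norm (\<Sum>\<alpha> | length \<alpha> = k. scale_op (c \<alpha>) (word_op X \<alpha>))
    \<le> sqrt (\<Sum>\<alpha> | length \<alpha> = k. (cmod (c \<alpha>))\<^sup>2) * sqrt (norm (\<Sum>i\<in>UNIV. X i o\<^sub>L adj (X i))) ^ k"
    (is "norm ?T \<le> ?C * sqrt ?R ^ k")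
proof (rule norm_blinfun_bound)
  fix x
  let ?S = "{\<alpha> :: 'n list. length \<alpha> = k}"
  let ?y = "?T x"
  have "(norm ?y)\<^sup>2 = Re (\<Sum>\<alpha>\<in>?S. c \<alpha> * cinner x (adj (word_op X \<alpha>) ?y))"
    using cinner_self[of ?y]
    by (simp add: blinfun.sum_left cinner_sum_left cinner_scaleC_left cinner_adj clinear_word_op lin)
  also have "\<dots> \<le> (\<Sum>\<alpha>\<in>?S. cmod (c \<alpha>) * (norm x * norm (adj (word_op X \<alpha>) ?y)))"
    by (intro order_trans[OF complex_Re_le_cmod] order_trans[OF norm_sum] sum_mono)
      (simp add: norm_mult mult_left_mono Cauchy_Schwarz_cinner)
  also have "\<dots> = norm x * (\<Sum>\<alpha>\<in>?S. cmod (c \<alpha>) * norm (adj (word_op X \<alpha>) ?y))"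
    by (simp add: sum_distrib_left mult_ac)
  also have "\<dots> \<le> norm x * (?C * sqrt (\<Sum>\<alpha>\<in>?S. (norm (adj (word_op X \<alpha>) ?y))\<^sup>2))"
    using L2_set_mult_ineq[of "\<lambda>\<alpha>. cmod (c \<alpha>)" "\<lambda>\<alpha>. norm (adj (word_op X \<alpha>) ?y)" ?S]
    by (intro mult_left_mono) (auto simp: L2_set_def)
  also have "\<dots> \<le> norm x * (?C * sqrt (?R ^ k * (norm ?y)\<^sup>2))"
    by (intro mult_left_mono real_sqrt_le_mono row_adj_bound lin) (auto intro: sum_nonneg)
  finally have "norm ?y * norm ?y \<le> (?C * sqrt ?R ^ k * norm x) * norm ?y"
    by (simp add: real_sqrt_mult real_sqrt_power power2_eq_square[of "norm ?y"] mult_ac)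
  moreover have "0 \<le> ?C * sqrt ?R ^ k * norm x" by (auto intro!: mult_nonneg_nonneg sum_nonneg)
  ultimately show "norm ?y \<le> ?C * sqrt ?R ^ k * norm x"
    by (cases "norm ?y = 0") (auto simp: mult_le_cancel_right)
qed (auto intro!: mult_nonneg_nonneg sum_nonneg)

text \<open>
  The bound on the radius does not depend on the Hilbert space \<open>'a\<close>.
\<close>

theorem free_holomorphic_summable:
  fixes c :: "'n::finite list \<Rightarrow> complex" and X :: "'n \<Rightarrow> ('a::complex_hilbert \<Rightarrow>\<^sub>L 'a)"
  assumes R: "limsup (\<lambda>k. ereal ((\<Sum>\<alpha> | length \<alpha> = k. (cmod (c \<alpha>))\<^sup>2) powr (1 / (2 * real k)))) < ereal R"
    and lin: "\<And>i. clinear_op (X i)"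
    and X: "sqrt (norm (\<Sum>i\<in>UNIV. X i o\<^sub>L adj (X i))) * R < 1"
  shows "summable (\<lambda>k. \<Sum>\<alpha> | length \<alpha> = k. scale_op (c \<alpha>) (word_op X \<alpha>))"
proof -
  let ?s = "\<lambda>k. \<Sum>\<alpha> | length \<alpha> = k. (cmod (c \<alpha>))\<^sup>2"
  let ?t = "sqrt (norm (\<Sum>i\<in>UNIV. X i o\<^sub>L adj (X i)))"
  have s0: "0 \<le> ?s k" for k by (intro sum_nonneg) auto
  have ev0: "\<forall>\<^sub>F k in sequentially. ?s k powr (1 / (2 * real k)) < R"
    using Limsup_lessD[OF R] by simp
  then obtain k0 where "?s k0 powr (1 / (2 * real k0)) < R"
    by (auto simp: eventually_sequentially)
  hence R0: "0 < R" by (rule le_less_trans[rotated]) simp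
  have ev: "\<forall>\<^sub>F k in sequentially. sqrt (?s k) \<le> R ^ k"
    using ev0 eventually_gt_at_top[of 0]
  proof eventually_elim
    case (elim k)
    have "sqrt (?s k) = (?s k powr (1 / (2 * real k))) powr real k"
      using elim(2) s0[of k] by (simp add: powr_powr powr_half_sqrt)
    also have "\<dots> \<le> R powr real k"
      using elim(1) by (intro powr_mono2) auto
    also have "\<dots> = R ^ k" using R0 by (simp add: powr_realpow)
    finally show ?case .
  qed
  show ?thesis
  proof (rule summable_comparison_test_ev)
    show "\<forall>\<^sub>F k in sequentially.
        norm (\<Sum>\<alpha> | length \<alpha> = k. scale_op (c \<alpha>) (word_op X \<alpha>)) \<le> (?t * R) ^ k"
      using ev
    proof eventually_elim
      case (elim k)
      have "norm (\<Sum>\<alpha> | length \<alpha> = k. scale_op (c \<alpha>) (word_op X \<alpha>)) \<le> sqrt (?s k) * ?t ^ k"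
        by (intro norm_homogeneous_le lin)
      also have "\<dots> \<le> R ^ k * ?t ^ k"
        by (intro mult_right_mono elim) auto
      also have "\<dots> = (?t * R) ^ k"
        by (simp add: power_mult_distrib)
      finally show ?case .
    qed
    show "summable (\<lambda>k. (?t * R) ^ k)"
      using X R0 by (intro summable_geometric) (simp add: abs_mult)
  qed
qed

theorem free_holomorphicI:
  fixes c :: "'n::finite list \<Rightarrow> complex"
  assumes \<rho>: "\<rho> > 0"
    and sm: "\<And>X :: 'n \<Rightarrow> ('n fock \<Rightarrow>\<^sub>L 'n fock).
      (\<forall>i. clinear_op (X i)) \<Longrightarrow> sqrt (norm (\<Sum>i\<in>UNIV. X i o\<^sub>L adj (X i))) \<le> \<rho> \<Longrightarrow>
      summable (\<lambda>k. \<Sum>\<alpha> | length \<alpha> = k. scale_op (c \<alpha>) (word_op X \<alpha>))"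
  shows "free_holomorphic c"
proof -
  let ?s = "\<lambda>k. \<Sum>\<alpha> | length \<alpha> = k. (cmod (c \<alpha>))\<^sup>2"
  have s0: "0 \<le> ?s k" for k by (intro sum_nonneg) auto
  define S where "S = weighted_left_creation (\<lambda>_ :: 'n list. 1)"
  define X where "X i = \<rho> *\<^sub>R S i" for i
  have Sc: "coord (S i x) \<beta> = (case \<beta> of [] \<Rightarrow> 0 | j # \<alpha> \<Rightarrow> if j = i then coord x \<alpha> else 0)" for i x \<beta>
    unfolding S_def by (subst coord_weighted_left_creation) (auto split: list.splits)
  have Slin: "clinear_op (S i)" for i
    unfolding S_def by (intro clinear_weighted_left_creation) auto
  have Sb: "S i (ell2_basis \<alpha>) = ell2_basis (i # \<alpha>)" for i \<alpha>
    unfolding S_def by (subst weighted_left_creation_basis) auto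
  have Sadj: "coord (adj (S i) y) \<alpha> = coord y (i # \<alpha>)" for i y \<alpha>
  proof -
    have "coord (adj (S i) y) \<alpha> = cnj (cinner (S i (ell2_basis \<alpha>)) y)"
      by (metis Slin cinner_adj cinner_commute cinner_ell2_basis)
    also have "\<dots> = coord y (i # \<alpha>)"
      by (metis Sb cinner_commute cinner_ell2_basis)
    finally show ?thesis .
  qed
  have Xadj: "adj (X i) = \<rho> *\<^sub>R adj (S i)" for i
    by (rule adj_eqI)
      (simp add: X_def blinfun.scaleR_left scaleR_scaleC cinner_scaleC_left cinner_scaleC_right
        cinner_adj Slin)
  have Xlin: "clinear_op (X i)" for i
    using Slin[of i] by (simp add: clinear_op_def X_def blinfun.scaleR_left scaleR_scaleC scaleC_scaleC mult.commute)
  have "norm (\<Sum>i\<in>UNIV. X i o\<^sub>L adj (X i)) \<le> \<rho>\<^sup>2"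
  proof (rule norm_blinfun_bound)
    fix y :: "'n fock"
    define z where "z = (\<Sum>i\<in>UNIV. S i (adj (S i) y))"
    have coord_sum: "coord (\<Sum>i\<in>A. f i) \<beta> = (\<Sum>i\<in>A. coord (f i) \<beta>)"
      for f :: "'n \<Rightarrow> 'n fock" and A \<beta>
      by (induction A rule: infinite_finite_induct) (auto simp: plus_ell2.rep_eq zero_ell2.rep_eq)
    have "coord z \<beta> = (if \<beta> = [] then 0 else coord y \<beta>)" for \<beta>
      by (cases \<beta>) (simp_all add: z_def coord_sum Sc Sadj)
    hence "(norm z)\<^sup>2 \<le> (norm y)\<^sup>2"
      unfolding norm_ell2_sq by (intro infsum_mono coord_summable) (use coord_summable[of z] in auto)
    hence "norm z \<le> norm y" by (rule power2_le_imp_le) simp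
    moreover have "(\<Sum>i\<in>UNIV. X i o\<^sub>L adj (X i)) y = \<rho>\<^sup>2 *\<^sub>R z"
      by (simp add: blinfun.sum_left Xadj[unfolded X_def] X_def z_def blinfun.scaleR_left blinfun.scaleR_right
          scaleR_sum_right power2_eq_square)
    ultimately show "norm ((\<Sum>i\<in>UNIV. X i o\<^sub>L adj (X i)) y) \<le> \<rho>\<^sup>2 * norm y"
      by (simp add: mult_left_mono)
  qed simp
  hence "sqrt (norm (\<Sum>i\<in>UNIV. X i o\<^sub>L adj (X i))) \<le> \<rho>"
    using \<rho> by (simp add: real_le_lsqrt)
  hence "summable (\<lambda>k. \<Sum>\<alpha> | length \<alpha> = k. scale_op (c \<alpha>) (word_op X \<alpha>))"
    using sm Xlin by blast
  hence "(\<lambda>k. \<Sum>\<alpha> | length \<alpha> = k. scale_op (c \<alpha>) (word_op X \<alpha>)) \<longlonglongrightarrow> 0"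
    by (rule summable_LIMSEQ_zero)
  hence "Bseq (\<lambda>k. \<Sum>\<alpha> | length \<alpha> = k. scale_op (c \<alpha>) (word_op X \<alpha>))"
    by (intro convergent_imp_Bseq convergentI)
  then obtain C where C: "C > 0"
      "\<And>k. norm (\<Sum>\<alpha> | length \<alpha> = k. scale_op (c \<alpha>) (word_op X \<alpha>)) \<le> C"
    unfolding Bseq_def by auto
  have XW: "word_op X \<alpha> (ell2_basis []) = \<rho> ^ length \<alpha> *\<^sub>R ell2_basis \<alpha>" for \<alpha>
    by (induction \<alpha>) (auto simp: X_def blinfun.scaleR_left blinfun.scaleR_right Sb)
  have norm_basis: "norm (ell2_basis i :: 'n fock) = 1" for i
  proof -
    have "complex_of_real ((norm (ell2_basis i :: 'n fock))\<^sup>2) = 1"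
      by (simp only: cinner_self[symmetric] ell2_basis_orthonormal if_True refl)
    hence "(norm (ell2_basis i :: 'n fock))\<^sup>2 = 1" by (simp only: of_real_eq_1_iff)
    thus ?thesis using power2_eq_imp_eq[of "norm (ell2_basis i :: 'n fock)" 1] by simp
  qed
  have key: "sqrt (?s k) * \<rho> ^ k \<le> C" for k
  proof -
    define v where "v = (\<Sum>\<alpha> | length \<alpha> = k. (c \<alpha> * \<rho> ^ k) *\<^sub>C (ell2_basis \<alpha> :: 'n fock))"
    have v: "(\<Sum>\<alpha> | length \<alpha> = k. scale_op (c \<alpha>) (word_op X \<alpha>)) (ell2_basis []) = v"
      by (auto simp: v_def blinfun.sum_left XW scaleR_scaleC scaleC_scaleC intro!: sum.cong)
    have v_coord: "coord v \<beta> = c \<beta> * \<rho> ^ k" if "length \<beta> = k" for \<beta>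
    proof -
      have "coord v \<beta> = (\<Sum>\<alpha> | length \<alpha> = k. if \<alpha> = \<beta> then c \<beta> * \<rho> ^ k else 0)"
        unfolding cinner_ell2_basis[symmetric] v_def cinner_sum_left
        by (intro sum.cong) (auto simp: cinner_scaleC_left ell2_basis_orthonormal)
      thus ?thesis using that by simp
    qed
    have "(sqrt (?s k) * \<rho> ^ k)\<^sup>2 = ?s k * (\<rho> ^ k)\<^sup>2"
      using s0[of k] by (simp add: power_mult_distrib)
    also have "\<dots> = (\<Sum>\<alpha> | length \<alpha> = k. (cmod (coord v \<alpha>))\<^sup>2)"
      unfolding sum_distrib_right
      by (intro sum.cong) (use \<rho> in \<open>auto simp: v_coord norm_mult norm_power power_mult_distrib\<close>)
    also have "\<dots> \<le> (norm v)\<^sup>2" by (rule ell2_partial_sum_le) simp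
    finally have "sqrt (?s k) * \<rho> ^ k \<le> norm v" by (rule power2_le_imp_le) simp
    moreover have "norm v \<le> C * 1"
      unfolding v[symmetric] norm_basis[of "[]", symmetric]
      by (rule order_trans[OF norm_blinfun]) (intro mult_right_mono C norm_ge_zero)
    ultimately show ?thesis by simp
  qed
  have "?s k powr (1 / (2 * real k)) \<le> max 1 C / \<rho>" if k: "k > 0" for k
  proof -
    have "sqrt (?s k) \<le> max 1 C / \<rho> ^ k"
      using key[of k] \<rho> by (simp add: field_simps)
    also have "\<dots> \<le> (max 1 C / \<rho>) ^ k"
    proof -
      have "max 1 C \<le> max 1 C ^ k" using k by (intro self_le_power) auto
      thus ?thesis using \<rho> by (simp add: power_divide divide_right_mono)
    qed
    finally have le: "sqrt (?s k) \<le> (max 1 C / \<rho>) ^ k" .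
    have "?s k powr (1 / (2 * real k)) = sqrt (?s k) powr (1 / real k)"
      using s0[of k] by (simp add: powr_half_sqrt[symmetric] powr_powr)
    also have "\<dots> \<le> ((max 1 C / \<rho>) ^ k) powr (1 / real k)"
      using le s0[of k] by (intro powr_mono2) auto
    also have "\<dots> = max 1 C / \<rho>"
      using k \<rho> by (simp add: powr_realpow[symmetric] powr_powr)
    finally show ?thesis .
  qed
  hence "\<forall>\<^sub>F k in sequentially. ereal (?s k powr (1 / (2 * real k))) \<le> ereal (max 1 C / \<rho>)"
    unfolding eventually_sequentially by (intro exI[of _ 1]) auto
  hence "limsup (\<lambda>k. ereal (?s k powr (1 / (2 * real k)))) \<le> ereal (max 1 C / \<rho>)"
    by (rule Limsup_bounded)
  also have "\<dots> < \<infinity>" by simp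
  finally show ?thesis unfolding free_holomorphic_def .
qed

end

theory Submission
  imports Defs
begin

text \<open>
  The partial sums of \<open>\<Sum> a\<^sub>\<alpha> W\<^sub>\<alpha> W\<^sub>\<alpha>\<^sup>*\<close> are diagonal, and \<open>a * b = 1\<close> makes their norm limit
  the projection \<open>P\<close> onto the vacuum vector \<open>e\<close>; hence \<open>P\<close> lies in \<open>C\<^sup>*(W)\<close>.  If \<open>\<pi>\<close> is not of
  Cuntz type, then \<open>\<pi>(P)\<close> fixes some \<open>\<xi> \<noteq> 0\<close>, and \<open>P T P = \<langle>T e, e\<rangle> P\<close> gives
  \<open>\<parallel>\<pi>(T) \<xi>\<parallel> = \<parallel>T e\<parallel> \<parallel>\<xi>\<parallel>\<close> for every \<open>T\<close> in \<open>C\<^sup>*(W)\<close>.  Applied to \<open>T X\<close> and to \<open>X\<close>, where the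
  vectors \<open>X e\<close> are dense, this forces \<open>\<parallel>T\<parallel> \<le> \<parallel>\<pi>(T)\<parallel>\<close>.  So \<open>\<pi>\<close> is isometric, and its range is
  closed and equal to \<open>C\<^sup>*(V)\<close>.
\<close>

section \<open>Adjoints and scalar multiples\<close>

lemma cinner_adj_left:
  assumes "clinear_op T"
  shows "cinner (adj T x) y = cinner x (T y)"
  by (metis cinner_adj[OF assms] cinner_commute)

lemma adj_adj:
  assumes "clinear_op T"
  shows "adj (adj T) = T"
  by (rule adj_eqI) (rule cinner_adj_left[OF assms])

text \<open>Cauchy-Schwarz bounds \<open>(norm (adj T y))^2\<close>, the inner product of
  \<open>T (adj T y)\<close> with \<open>y\<close>, and one factor \<open>norm (adj T y)\<close>
  cancels.\<close>

lemma norm_adj_le: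
  assumes T: "clinear_op T"
  shows "norm (adj T) \<le> norm T"
proof (rule norm_blinfun_bound)
  fix y
  have "(norm (adj T y))\<^sup>2 = inner (T (adj T y)) y"
    by (simp add: power2_norm_eq_inner inner_eq_Re_cinner cinner_adj[OF T])
  also have "\<dots> \<le> norm T * norm (adj T y) * norm y"
    by (rule order_trans[OF norm_cauchy_schwarz]) (intro mult_right_mono norm_blinfun norm_ge_zero)
  finally have "norm (adj T y) * norm (adj T y) \<le> norm (adj T y) * (norm T * norm y)"
    by (simp add: power2_eq_square mult_ac)
  thus "norm (adj T y) \<le> norm T * norm y"
    by (cases "norm (adj T y) = 0") (auto simp: mult_le_cancel_left)
qed simp

lemma scale_op_of_real: "scale_op (complex_of_real r) T = r *\<^sub>R T"
  by (rule blinfun_eqI) (simp add: blinfun.scaleR_left scaleR_scaleC)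

text \<open>Complex linearity recovers \<open>Im\<close> of the complex product from its
  \<open>Re\<close> by passing to \<open>\<i> *\<^sub>C x\<close>. Real symmetry is a pointwise
  closed condition, so it suits the fixed-point argument below better than
  \<open>adj Y = Y\<close>.\<close>

lemma clinear_symmetric_adj:
  assumes T: "clinear_op T" and sym: "\<And>x y. inner (T x) y = inner x (T y)"
  shows "adj T = T"
proof (rule adj_eqI, rule complex_eqI)
  fix x y
  show "Re (cinner (T x) y) = Re (cinner x (T y))"
    using sym by (simp add: inner_eq_Re_cinner)
  show "Im (cinner (T x) y) = Im (cinner x (T y))"
    using sym[of "\<i> *\<^sub>C x" y] T by (simp add: inner_eq_Re_cinner clinear_op_def cinner_scaleC_left)
qed

section \<open>Concrete \<open>C\<^sup>*\<close>-algebras and their representations\<close>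

lemma cstar_subalgebraD:
  assumes "cstar_subalgebra A"
  shows "T \<in> A \<Longrightarrow> clinear_op T" "0 \<in> A" "S \<in> A \<Longrightarrow> T \<in> A \<Longrightarrow> S + T \<in> A"
    "S \<in> A \<Longrightarrow> T \<in> A \<Longrightarrow> S o\<^sub>L T \<in> A" "T \<in> A \<Longrightarrow> scale_op c T \<in> A" "T \<in> A \<Longrightarrow> adj T \<in> A" "closed A"
  using assms by (auto simp: cstar_subalgebra_def)

lemma cstar_subalgebra_scaleR:
  assumes "cstar_subalgebra A" "T \<in> A"
  shows "r *\<^sub>R T \<in> A"
  using cstar_subalgebraD(5)[OF assms, of "complex_of_real r"] by (simp add: scale_op_of_real)

lemma cstar_subalgebra_diff:
  assumes "cstar_subalgebra A" "S \<in> A" "T \<in> A"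
  shows "S - T \<in> A"
  using cstar_subalgebraD(3)[OF assms(1,2) cstar_subalgebra_scaleR[OF assms(1,3), of "-1"]] by simp

lemma cstar_subalgebra_sum:
  assumes "cstar_subalgebra A" "\<And>i. i \<in> I \<Longrightarrow> f i \<in> A"
  shows "sum f I \<in> A"
  using assms(2)
  by (induction I rule: infinite_finite_induct) (auto intro: cstar_subalgebraD[OF assms(1)])

lemma cstar_subalgebra_word_op:
  assumes "cstar_subalgebra A" "id_blinfun \<in> A" "\<And>i. X i \<in> A"
  shows "word_op X \<alpha> \<in> A"
  using assms by (induction \<alpha>) (auto intro: cstar_subalgebraD)

text \<open>
  Writing the square root of \<open>1 - S\<close> as \<open>1 - Y\<close> turns the equation into \<open>Y = (S + Y\<^sup>2) / 2\<close>,
  whose right-hand side contracts the ball of radius \<open>1 - sqrt (1 - \<parallel>S\<parallel>)\<close>.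
\<close>

lemma cstar_sqrt_one_minus:
  assumes A: "cstar_subalgebra A" and S: "S \<in> A" "adj S = S" "norm S < 1"
  obtains Y where "Y \<in> A" "adj Y = Y" "2 *\<^sub>R Y = S + (Y o\<^sub>L Y)"
proof -
  note AD = cstar_subalgebraD[OF A]
  \<comment> \<open>The smaller root of \<open>norm S + r^2 = 2 * r\<close>: this makes
    \<open>F\<close> preserve the ball, and \<open>r < 1\<close> doubles as the contraction
    constant.\<close>
  define r where "r = 1 - sqrt (1 - norm S)"
  define F where "F Y = (1/2) *\<^sub>R (S + (Y o\<^sub>L Y))" for Y
  define B where "B = A \<inter> {Y :: 'a \<Rightarrow>\<^sub>L 'a. \<forall>x y. inner (Y x) y = inner x (Y y)} \<inter> cball 0 r"
  have r: "0 \<le> r" "r < 1" "norm S + r\<^sup>2 = 2 * r"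
    using S(3) by (auto simp: r_def power2_diff)
  have symS: "inner (S x) y = inner x (S y)" for x y
    using cinner_adj[OF AD(1)[OF S(1)]] S(2) by (simp add: inner_eq_Re_cinner)
  have "closed {Y :: 'a \<Rightarrow>\<^sub>L 'a. \<forall>x y. inner (Y x) y = inner x (Y y)}"
    by (intro closed_Collect_all closed_Collect_eq continuous_intros)
  hence "complete B"
    unfolding B_def complete_eq_closed by (intro closed_Int AD closed_cball)
  moreover have "0 \<in> B" using r AD by (simp add: B_def)
  moreover have "F ` B \<subseteq> B"
  proof (rule image_subsetI)
    fix Y assume Y: "Y \<in> B"
    have "norm (F Y) \<le> (1/2) * (norm S + norm Y * norm Y)"
      unfolding F_def by (simp add: order_trans[OF norm_triangle_ineq] norm_blinfun_compose)
    also have "\<dots> \<le> (1/2) * (norm S + r * r)"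
      using Y r by (intro mult_left_mono add_left_mono mult_mono) (auto simp: B_def)
    also have "\<dots> = r" using r(3) by (simp add: power2_eq_square)
    finally show "F Y \<in> B"
      using Y S AD cstar_subalgebra_scaleR[OF A]
      by (auto simp: B_def F_def blinfun.add_left blinfun.scaleR_left inner_add_left inner_add_right symS)
  qed
  moreover have "dist (F Y) (F Z) \<le> r * dist Y Z" if "Y \<in> B" "Z \<in> B" for Y Z
  proof -
    \<comment> \<open>A splitting of \<open>Y^2 - Z^2\<close> valid without commutativity.\<close>
    have "F Y - F Z = (1/2) *\<^sub>R ((Y o\<^sub>L (Y - Z)) + ((Y - Z) o\<^sub>L Z))"
      by (rule blinfun_eqI)
        (simp add: F_def blinfun.add_left blinfun.diff_left blinfun.diff_right blinfun.scaleR_left algebra_simps)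
    hence "norm (F Y - F Z) \<le> (1/2) * (norm Y * norm (Y - Z) + norm (Y - Z) * norm Z)"
      by (simp add: order_trans[OF norm_triangle_ineq] add_mono norm_blinfun_compose)
    also have "\<dots> \<le> (1/2) * (r * norm (Y - Z) + norm (Y - Z) * r)"
      using that by (intro mult_left_mono add_mono mult_right_mono mult_left_mono) (auto simp: B_def)
    finally show ?thesis by (simp add: dist_norm mult.commute)
  qed
  ultimately have "\<exists>!Y\<in>B. F Y = Y"
    using r by (intro Banach_fix[of B r F]) auto
  then obtain Y where Y: "Y \<in> B" "F Y = Y" by blast
  have "adj Y = Y" using Y AD by (intro clinear_symmetric_adj) (auto simp: B_def)
  moreover have "2 *\<^sub>R Y = S + (Y o\<^sub>L Y)"
    using arg_cong[OF Y(2), of "\<lambda>Y. 2 *\<^sub>R Y"] by (simp add: F_def)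
  moreover have "Y \<in> A" using Y by (simp add: B_def)
  ultimately show thesis using that by blast
qed

section \<open>Representations: contractivity, norm continuity, images and preimages\<close>

locale cstar_rep =
  fixes A :: "('a::complex_hilbert \<Rightarrow>\<^sub>L 'a) set"
    and \<pi> :: "('a \<Rightarrow>\<^sub>L 'a) \<Rightarrow> ('k::complex_hilbert \<Rightarrow>\<^sub>L 'k)"
  assumes alg: "cstar_subalgebra A" and one_mem: "id_blinfun \<in> A" and rep: "unital_star_rep A \<pi>"
begin

lemmas algD = cstar_subalgebraD[OF alg]

lemma rep_hom:
  shows "T \<in> A \<Longrightarrow> clinear_op (\<pi> T)"
    and "S \<in> A \<Longrightarrow> T \<in> A \<Longrightarrow> \<pi> (S + T) = \<pi> S + \<pi> T"
    and "S \<in> A \<Longrightarrow> T \<in> A \<Longrightarrow> \<pi> (S o\<^sub>L T) = \<pi> S o\<^sub>L \<pi> T"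
    and "T \<in> A \<Longrightarrow> \<pi> (scale_op c T) = scale_op c (\<pi> T)"
    and "T \<in> A \<Longrightarrow> \<pi> (adj T) = adj (\<pi> T)"
    and "\<pi> id_blinfun = id_blinfun"
  using rep by (auto simp: unital_star_rep_def star_hom_def)

lemma rep_scaleR: "T \<in> A \<Longrightarrow> \<pi> (r *\<^sub>R T) = r *\<^sub>R \<pi> T"
  using rep_hom(4)[of T "complex_of_real r"] by (simp add: scale_op_of_real)

lemma rep_zero: "\<pi> 0 = 0"
  using rep_scaleR[of 0 0] algD by simp

lemma rep_diff: "S \<in> A \<Longrightarrow> T \<in> A \<Longrightarrow> \<pi> (S - T) = \<pi> S - \<pi> T"
  using rep_hom(2)[of S "(-1) *\<^sub>R T"] rep_scaleR[of T "-1"] cstar_subalgebra_scaleR[OF alg, of T "-1"]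
  by simp

lemma rep_sum: "(\<And>i. i \<in> I \<Longrightarrow> f i \<in> A) \<Longrightarrow> \<pi> (sum f I) = (\<Sum>i\<in>I. \<pi> (f i))"
  by (induction I rule: infinite_finite_induct)
    (auto simp: rep_zero rep_hom cstar_subalgebra_sum[OF alg])

lemma rep_norm_sq: "T \<in> A \<Longrightarrow> complex_of_real ((norm (\<pi> T x))\<^sup>2) = cinner (\<pi> (adj T o\<^sub>L T) x) x"
  by (simp add: cinner_self rep_hom algD cinner_adj_left)

text \<open>With \<open>S\<close> the product of \<open>adj T\<close> and \<open>T\<close>, the
  square root gives \<open>1 - S = (1 - Y)^2\<close> for a self-adjoint \<open>Y\<close> in
  \<open>A\<close>. Applying \<open>\<pi>\<close> shows that
  \<open>(norm x)^2 - (norm (\<pi> T x))^2\<close> is the square of a norm.\<close>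

lemma rep_contraction:
  assumes T: "T \<in> A" "norm T < 1"
  shows "norm (\<pi> T) \<le> 1"
proof (rule norm_blinfun_bound)
  fix x
  define S where "S = adj T o\<^sub>L T"
  have S: "S \<in> A" using T algD by (simp add: S_def)
  have lin: "clinear_op T" "clinear_op (adj T)" using T algD by auto
  have adjS: "adj S = S" by (simp add: S_def adj_compose adj_adj lin)
  have "norm S \<le> norm T * norm T"
    unfolding S_def
    by (intro order_trans[OF norm_blinfun_compose] mult_right_mono norm_adj_le lin) simp
  also have "\<dots> < 1" using mult_strict_mono[of "norm T" 1 "norm T" 1] T by simp
  finally obtain Y where Y: "Y \<in> A" "adj Y = Y" "2 *\<^sub>R Y = S + (Y o\<^sub>L Y)"
    using cstar_sqrt_one_minus[OF alg S adjS] by blast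
  have "2 *\<^sub>R \<pi> Y = \<pi> (2 *\<^sub>R Y)" using Y(1) by (simp only: rep_scaleR)
  also have "\<dots> = \<pi> S + (\<pi> Y o\<^sub>L \<pi> Y)"
    unfolding Y(3) using Y(1) S algD by (simp add: rep_hom)
  finally have "(2 *\<^sub>R \<pi> Y) x = (\<pi> S + (\<pi> Y o\<^sub>L \<pi> Y)) x" by simp
  hence eq: "\<pi> S x = 2 *\<^sub>R \<pi> Y x - \<pi> Y (\<pi> Y x)"
    by (simp add: blinfun.add_left blinfun.scaleR_left)
  have sym: "inner (\<pi> Y u) v = inner u (\<pi> Y v)" for u v
    using cinner_adj[OF rep_hom(1)[OF Y(1)]] rep_hom(5)[OF Y(1)] Y(2)
    by (simp add: inner_eq_Re_cinner)
  have "(norm (\<pi> T x))\<^sup>2 = inner (\<pi> S x) x"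
    using arg_cong[OF rep_norm_sq[OF T(1)], of Re x] by (simp add: S_def inner_eq_Re_cinner)
  also have "\<dots> = (norm x)\<^sup>2 - (norm (x - \<pi> Y x))\<^sup>2"
    by (simp add: eq power2_norm_eq_inner inner_diff_left inner_diff_right sym inner_commute)
  also have "\<dots> \<le> (norm x)\<^sup>2" by simp
  finally show "norm (\<pi> T x) \<le> 1 * norm x" by simp
qed simp

text \<open>The contraction bound asks for norm strictly below 1, so \<open>T\<close> is divided by
  an arbitrary \<open>r > norm T\<close>, and \<open>r\<close> then decreases to
  \<open>norm T\<close>.\<close>

lemma rep_norm_le:
  assumes T: "T \<in> A"
  shows "norm (\<pi> T) \<le> norm T"
proof (rule dense_ge)
  fix r assume r: "norm T < r"
  hence r0: "0 < r" by (rule le_less_trans[rotated]) simp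
  have "norm (\<pi> ((1 / r) *\<^sub>R T)) \<le> 1"
    using T r r0 by (intro rep_contraction cstar_subalgebra_scaleR[OF alg]) auto
  thus "norm (\<pi> T) \<le> r" using r0 T by (simp add: rep_scaleR field_simps)
qed

lemma rep_tendsto:
  assumes "\<And>k::nat. X k \<in> A" "X \<longlonglongrightarrow> T"
  shows "T \<in> A" and "(\<lambda>k. \<pi> (X k)) \<longlonglongrightarrow> \<pi> T"
proof -
  show T: "T \<in> A" by (rule closed_sequentially[OF algD(7) assms])
  have "(\<lambda>k. norm (X k - T)) \<longlonglongrightarrow> 0"
    using assms(2) by (simp add: LIM_zero tendsto_norm_zero)
  hence "(\<lambda>k. \<pi> (X k) - \<pi> T) \<longlonglongrightarrow> 0"
    by (rule Lim_null_comparison[rotated])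
      (use T assms in \<open>simp add: rep_diff[symmetric] rep_norm_le cstar_subalgebra_diff[OF alg]\<close>)
  thus "(\<lambda>k. \<pi> (X k)) \<longlonglongrightarrow> \<pi> T" by (rule LIM_zero_cancel)
qed

text \<open>Only closedness uses the isometry: a convergent sequence in the image lifts to a Cauchy
  sequence in \<open>A\<close>, whose limit is mapped to the given limit.\<close>

lemma image_isometric_cstar_subalgebra:
  assumes iso: "\<And>T. T \<in> A \<Longrightarrow> norm (\<pi> T) = norm T"
  shows "cstar_subalgebra (\<pi> ` A)"
proof -
  have "closed (\<pi> ` A)"
    unfolding closed_sequential_limits
  proof (intro allI impI, elim conjE)
    fix Y l assume "\<forall>n. Y n \<in> \<pi> ` A" and l: "Y \<longlonglongrightarrow> l"
    then have "\<forall>n. \<exists>T. T \<in> A \<and> Y n = \<pi> T" by blast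
    then obtain X where X: "\<And>n. X n \<in> A" "\<And>n. Y n = \<pi> (X n)" by metis
    have "dist (X m) (X n) = dist (Y m) (Y n)" for m n
      using iso[of "X m - X n"] X by (simp add: dist_norm rep_diff cstar_subalgebra_diff[OF alg])
    hence "Cauchy X" using LIMSEQ_imp_Cauchy[OF l] by (simp add: Cauchy_def)
    then obtain T where "X \<longlonglongrightarrow> T" by (auto simp: Cauchy_convergent_iff convergent_def)
    from rep_tendsto[OF X(1) this] have "T \<in> A" "Y \<longlonglongrightarrow> \<pi> T" by (simp_all only: X(2)[symmetric])
    thus "l \<in> \<pi> ` A" using LIMSEQ_unique[OF l] by blast
  qed
  moreover have "0 \<in> \<pi> ` A" using imageI[OF algD(2), of \<pi>] by (simp only: rep_zero)
  moreover have "\<pi> S + \<pi> T \<in> \<pi> ` A" "\<pi> S o\<^sub>L \<pi> T \<in> \<pi> ` A" "scale_op c (\<pi> T) \<in> \<pi> ` A"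
    "adj (\<pi> T) \<in> \<pi> ` A" if "S \<in> A" "T \<in> A" for S T c
    using that by (simp_all only: rep_hom(2-5)[symmetric] algD imageI)
  ultimately show ?thesis
    unfolding cstar_subalgebra_def using rep_hom(1) by blast
qed

text \<open>This permits induction over a generated algebra: once the generators are mapped into
  \<open>B\<close>, minimality of the hull does the rest. Closedness follows from the continuity of
  \<open>\<pi>\<close>.\<close>

lemma vimage_cstar_subalgebra:
  assumes B: "cstar_subalgebra B"
  shows "cstar_subalgebra {T \<in> A. \<pi> T \<in> B}"
proof -
  have "closed {T \<in> A. \<pi> T \<in> B}"
    unfolding closed_sequential_limits
  proof (intro allI impI, elim conjE)
    fix X T assume X: "\<forall>n. X n \<in> {T \<in> A. \<pi> T \<in> B}" "X \<longlonglongrightarrow> T"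
    hence "T \<in> A" "(\<lambda>n. \<pi> (X n)) \<longlonglongrightarrow> \<pi> T" using rep_tendsto[of X T] by auto
    moreover have "\<pi> T \<in> B"
      by (rule closed_sequentially[OF cstar_subalgebraD(7)[OF B] _ calculation(2)]) (use X in auto)
    ultimately show "T \<in> {T \<in> A. \<pi> T \<in> B}" by simp
  qed
  thus ?thesis
    unfolding cstar_subalgebra_def
    using rep_zero algD cstar_subalgebraD[OF B] by (simp add: rep_hom)
qed

end

text \<open>Both inclusions come from minimality of the hull, applied to the preimage of
  \<open>Cstar (\<lambda>i. \<pi> (X i))\<close> and to the image of \<open>Cstar X\<close>.\<close>

lemma isometric_rep_image_Cstar:
  assumes lin: "\<And>i. clinear_op (X i)" and rep: "unital_star_rep (Cstar X) \<pi>"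
    and iso: "\<And>T. T \<in> Cstar X \<Longrightarrow> norm (\<pi> T) = norm T"
  shows "\<pi> ` Cstar X = Cstar (\<lambda>i. \<pi> (X i))"
proof -
  note C = cstar_subalgebra_Cstar[of X, OF lin]
  interpret cstar_rep "Cstar X" \<pi> using C rep by unfold_locales
  have linV: "clinear_op (\<pi> (X i))" for i using C rep_hom by simp
  note CV = cstar_subalgebra_Cstar[of "\<lambda>i. \<pi> (X i)", OF linV]
  have "Cstar X \<subseteq> {T \<in> Cstar X. \<pi> T \<in> Cstar (\<lambda>i. \<pi> (X i))}"
  proof -
    have "cstar_subalgebra hull (insert id_blinfun (range X)) \<subseteq> {T \<in> Cstar X. \<pi> T \<in> Cstar (\<lambda>i. \<pi> (X i))}"
      using C CV rep_hom(6) by (intro hull_minimal vimage_cstar_subalgebra) auto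
    thus ?thesis by (simp only: Cstar_def[of X, symmetric])
  qed
  moreover have "Cstar (\<lambda>i. \<pi> (X i)) \<subseteq> \<pi> ` Cstar X"
    unfolding Cstar_def[of "\<lambda>i. \<pi> (X i)"]
  proof (rule hull_minimal)
    have "id_blinfun \<in> \<pi> ` Cstar X" using imageI[OF C(2), of \<pi>] by (simp only: rep_hom(6))
    thus "insert id_blinfun (range (\<lambda>i. \<pi> (X i))) \<subseteq> \<pi> ` Cstar X" using C(3) by blast
    show "cstar_subalgebra (\<pi> ` Cstar X)" by (rule image_isometric_cstar_subalgebra) (rule iso)
  qed
  ultimately show ?thesis by blast
qed

section \<open>Weighted left creation operators\<close>

lemma coord_sum: "coord (\<Sum>i\<in>I. f i) \<beta> = (\<Sum>i\<in>I. coord (f i) \<beta>)"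
  by (induction I rule: infinite_finite_induct) (auto simp: plus_ell2.rep_eq zero_ell2.rep_eq)

lemma tendsto_coord: "(X \<longlongrightarrow> x) F \<Longrightarrow> ((\<lambda>k. coord (X k) i) \<longlongrightarrow> coord x i) F"
proof -
  assume X: "(X \<longlongrightarrow> x) F"
  have "((\<lambda>k. norm (X k - x)) \<longlongrightarrow> 0) F" using X by (simp add: LIM_zero tendsto_norm_zero)
  hence "((\<lambda>k. coord (X k) i - coord x i) \<longlongrightarrow> 0) F"
  proof (rule Lim_null_comparison[rotated], intro always_eventually allI)
    show "norm (coord (X k) i - coord x i) \<le> norm (X k - x)" for k
      using coord_le_norm[of "X k - x" i] by (simp add: minus_ell2.rep_eq)
  qed
  thus ?thesis by (rule LIM_zero_cancel)
qed

text \<open>The squared norm of the remainder is \<open>(norm x)^2\<close> minus a finite partial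
  sum of the series defining it, hence tends to 0.\<close>

lemma ell2_basis_expansion:
  fixes x :: "'i ell2"
  shows "((\<lambda>F. \<Sum>i\<in>F. coord x i *\<^sub>C ell2_basis i) \<longlongrightarrow> x) (finite_subsets_at_top UNIV)"
proof -
  let ?s = "\<lambda>F. \<Sum>i\<in>F. coord x i *\<^sub>C ell2_basis i"
  let ?n = "\<lambda>F. \<Sum>i\<in>F. (cmod (coord x i))\<^sup>2"
  have coord_s: "coord (?s F) j = (if j \<in> F then coord x j else 0)" if "finite F" for F j
  proof -
    have "coord (?s F) j = (\<Sum>i\<in>F. if j = i then coord x j else 0)"
      unfolding coord_sum by (intro sum.cong) (auto simp: scaleC_ell2.rep_eq ell2_basis.rep_eq)
    thus ?thesis using that by simp
  qed
  have sq: "(norm (x - ?s F))\<^sup>2 = (norm x)\<^sup>2 - ?n F" if F: "finite F" for F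
  proof -
    have "(norm (x - ?s F))\<^sup>2 = (\<Sum>\<^sub>\<infinity>i\<in>UNIV - F. (cmod (coord x i))\<^sup>2)"
      unfolding norm_ell2_sq
      by (rule infsum_cong_neutral) (auto simp: minus_ell2.rep_eq coord_s[OF F])
    also have "\<dots> = (norm x)\<^sup>2 - ?n F"
      unfolding norm_ell2_sq using F
      by (subst infsum_Diff[OF coord_summable summable_on_finite[OF F]]) auto
    finally show ?thesis .
  qed
  have "(?n \<longlongrightarrow> (norm x)\<^sup>2) (finite_subsets_at_top UNIV)"
    using has_sum_infsum[OF coord_summable[of x]] by (simp add: norm_ell2_sq has_sum_def)
  from tendsto_diff[OF tendsto_const[of "(norm x)\<^sup>2"] this]
  have "((\<lambda>F. (norm x)\<^sup>2 - ?n F) \<longlongrightarrow> 0) (finite_subsets_at_top UNIV)" by simp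
  hence "((\<lambda>F. (norm (x - ?s F))\<^sup>2) \<longlongrightarrow> 0) (finite_subsets_at_top UNIV)"
    by (rule Lim_transform_eventually)
      (auto intro!: eventually_finite_subsets_at_top_weakI simp: sq)
  hence "((\<lambda>F. norm (x - ?s F)) \<longlongrightarrow> 0) (finite_subsets_at_top UNIV)"
    using tendsto_real_sqrt[of "\<lambda>F. (norm (x - ?s F))\<^sup>2" 0] by simp
  hence "((\<lambda>F. x - ?s F) \<longlongrightarrow> 0) (finite_subsets_at_top UNIV)" by (rule tendsto_norm_zero_cancel)
  from tendsto_diff[OF tendsto_const[of x] this] show ?thesis by simp
qed

section \<open>Weighted shifts, the vacuum projection and isometric representations\<close>

locale weighted_shift =
  fixes b :: "'n::finite list \<Rightarrow> real" and W :: "'n \<Rightarrow> ('n fock \<Rightarrow>\<^sub>L 'n fock)"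
  assumes b_Nil: "b [] = 1" and pos: "b \<alpha> > 0" and bdd: "bdd_above (range (\<lambda>\<alpha>. b \<alpha> / b (i # \<alpha>)))"
    and W_def: "W = weighted_left_creation b"
begin

lemma clinear_W: "clinear_op (W i)"
  unfolding W_def by (rule clinear_weighted_left_creation[OF pos bdd])

lemma W_basis: "W i (ell2_basis \<alpha>) = sqrt (b \<alpha> / b (i # \<alpha>)) *\<^sub>R ell2_basis (i # \<alpha>)"
  unfolding W_def by (rule weighted_left_creation_basis[OF pos bdd])

lemma coord_W: "coord (W i x) \<beta> = (case \<beta> of [] \<Rightarrow> 0
    | j # \<alpha> \<Rightarrow> if j = i then complex_of_real (sqrt (b \<alpha> / b (i # \<alpha>))) * coord x \<alpha> else 0)"
  unfolding W_def by (rule coord_weighted_left_creation[OF pos bdd])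

lemma coord_adj_W: "coord (adj (W i) y) \<alpha> = complex_of_real (sqrt (b \<alpha> / b (i # \<alpha>))) * coord y (i # \<alpha>)"
  using cinner_adj_left[OF clinear_W, of i y "ell2_basis \<alpha>"]
  by (simp add: W_basis cinner_ell2_basis scaleR_scaleC cinner_scaleC_right)

text \<open>The adjoint strips the prefix \<open>\<alpha>\<close> and the operator puts it back, so
  the product is diagonal. Each square-root weight occurs twice, and the resulting ratios telescope
  along the prefix.\<close>

lemma coord_word_op_W_adj:
  "coord (word_op W \<alpha> (adj (word_op W \<alpha>) x)) \<gamma> =
    (if \<alpha> = take (length \<alpha>) \<gamma> then complex_of_real (b (drop (length \<alpha>) \<gamma>) / b \<gamma>) * coord x \<gamma> else 0)"
proof (induction \<alpha> arbitrary: x \<gamma>)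
  case Nil
  have "adj (id_blinfun :: 'n fock \<Rightarrow>\<^sub>L 'n fock) = id_blinfun" by (rule adj_eqI) simp
  thus ?case using pos[of \<gamma>] by simp
next
  case (Cons i \<alpha>)
  have adj: "adj (W i o\<^sub>L word_op W \<alpha>) = adj (word_op W \<alpha>) o\<^sub>L adj (W i)"
    by (intro adj_compose clinear_W clinear_word_op)
  show ?case
  proof (cases \<gamma>)
    case Nil
    thus ?thesis by (simp add: adj coord_W)
  next
    case (Cons j \<delta>)
    \<comment> \<open>One factor \<open>?w\<close> comes from \<open>W i\<close> and one from its
      adjoint; \<open>b \<delta>\<close> cancels against the denominator in the induction
      hypothesis.\<close>
    let ?w = "sqrt (b \<delta> / b (i # \<delta>))"
    have "?w * ?w = b \<delta> / b (i # \<delta>)" "b \<delta> \<noteq> 0"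
      using pos[of \<delta>] pos[of "i # \<delta>"] by (simp_all del: real_sqrt_divide)
    moreover have "?w * (p / b \<delta> * ?w) = p / b \<delta> * (?w * ?w)" for p
      by (simp only: ac_simps)
    ultimately have "?w * (p / b \<delta> * ?w) = p / b (i # \<delta>)" for p
      by simp
    hence "complex_of_real ?w * (complex_of_real (p / b \<delta>) * (complex_of_real ?w * z)) =
        complex_of_real (p / b (i # \<delta>)) * z" for p z
      by (simp only: mult.assoc[symmetric] of_real_mult[symmetric])
    thus ?thesis
      by (simp add: Cons adj coord_W Cons.IH coord_adj_W del: real_sqrt_divide of_real_divide)
  qed
qed

text \<open>The weights telescope down to \<open>b [] = 1\<close>. Since the factor is nonzero, the
  vacuum vector is cyclic.\<close>

lemma word_op_W_vacuum: "word_op W \<alpha> (ell2_basis []) = (1 / sqrt (b \<alpha>)) *\<^sub>R ell2_basis \<alpha>"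
proof (induction \<alpha>)
  case (Cons i \<alpha>)
  have "sqrt (b \<alpha>) \<noteq> 0" using pos[of \<alpha>] by simp
  thus ?case by (simp add: Cons blinfun.scaleR_right W_basis real_sqrt_divide)
qed (simp add: b_Nil)

text \<open>At \<open>\<gamma>\<close> the term of degree \<open>k\<close> has diagonal entry
  \<open>a (take k \<gamma>) * b (drop k \<gamma>) / b \<gamma>\<close>, and it vanishes for
  \<open>k > length \<gamma>\<close>. The sum over \<open>k\<close> is therefore a convolution
  divided by \<open>b \<gamma>\<close>.\<close>

lemma defect_limit:
  assumes inv: "nc_inverse b a"
    and P: "(\<lambda>k. \<Sum>\<alpha> | length \<alpha> = k. a \<alpha> *\<^sub>R (word_op W \<alpha> o\<^sub>L adj (word_op W \<alpha>))) sums P"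
  shows "P x = coord x [] *\<^sub>C ell2_basis []"
proof (rule ell2_eqI)
  fix \<gamma> :: "'n list"
  let ?t = "\<lambda>k. \<Sum>\<alpha> | length \<alpha> = k. a \<alpha> *\<^sub>R (word_op W \<alpha> o\<^sub>L adj (word_op W \<alpha>))"
  let ?c = "\<lambda>k. a (take k \<gamma>) * b (drop k \<gamma>)"
  have t: "coord (?t k x) \<gamma> = (if k \<le> length \<gamma> then complex_of_real (?c k / b \<gamma>) * coord x \<gamma> else 0)" for k
  proof -
    have "coord (?t k x) \<gamma> =
        (\<Sum>\<alpha> | length \<alpha> = k. if \<alpha> = take k \<gamma> then complex_of_real (?c k / b \<gamma>) * coord x \<gamma> else 0)"
      unfolding blinfun.sum_left coord_sum
      by (intro sum.cong)
        (auto simp: blinfun.scaleR_left scaleR_ell2.rep_eq coord_word_op_W_adj)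
    thus ?thesis by (auto simp: min_def)
  qed
  have "(\<lambda>n. (\<Sum>k<n. ?t k) x) \<longlonglongrightarrow> P x"
    using P unfolding sums_def by (intro tendsto_intros)
  from tendsto_coord[OF this, of \<gamma>]
  have "(\<lambda>n. \<Sum>k<n. coord (?t k x) \<gamma>) \<longlonglongrightarrow> coord (P x) \<gamma>"
    by (simp only: blinfun.sum_left[of ?t] coord_sum)
  hence "(\<lambda>k. coord (?t k x) \<gamma>) sums coord (P x) \<gamma>" by (simp add: sums_def)
  moreover have "(\<lambda>k. coord (?t k x) \<gamma>) sums (\<Sum>k\<le>length \<gamma>. coord (?t k x) \<gamma>)"
    by (rule sums_finite) (auto simp: t)
  ultimately have "coord (P x) \<gamma> = (\<Sum>k\<le>length \<gamma>. coord (?t k x) \<gamma>)" by (rule sums_unique2)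
  also have "\<dots> = complex_of_real (nc_mult a b \<gamma> / b \<gamma>) * coord x \<gamma>"
    by (simp add: t nc_mult_def sum_distrib_right sum_divide_distrib del: of_real_divide of_real_mult)
  \<comment> \<open>Prefixes carry \<open>a\<close> and suffixes carry \<open>b\<close>, so the
    identity that enters is \<open>a * b = 1\<close>, in this order.\<close>
  also have "nc_mult a b \<gamma> = nc_one \<gamma>" using inv by (simp add: nc_inverse_def)
  also have "complex_of_real (nc_one \<gamma> / b \<gamma>) * coord x \<gamma> = coord (coord x [] *\<^sub>C ell2_basis []) \<gamma>"
    by (simp add: nc_one_def b_Nil scaleC_ell2.rep_eq ell2_basis.rep_eq)
  finally show "coord (P x) \<gamma> = coord (coord x [] *\<^sub>C ell2_basis []) \<gamma>" .
qed

text \<open>Finite combinations of basis vectors lie in the orbit of the vacuum under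
  \<open>A\<close> and are dense, and both sides of the bound are continuous.\<close>

lemma norm_le_on_vacuum_orbit:
  fixes T :: "'n fock \<Rightarrow>\<^sub>L 'c::real_normed_vector"
  assumes A: "cstar_subalgebra A" "id_blinfun \<in> A" "\<And>i. W i \<in> A"
    and le: "\<And>X. X \<in> A \<Longrightarrow> norm (T (X (ell2_basis []))) \<le> c * norm (X (ell2_basis []))"
  shows "norm (T x) \<le> c * norm x"
proof -
  let ?s = "\<lambda>F. \<Sum>\<alpha>\<in>F. coord x \<alpha> *\<^sub>C ell2_basis \<alpha>"
  have "norm (T (?s F)) \<le> c * norm (?s F)" for F
  proof -
    \<comment> \<open>The factor \<open>sqrt (b \<alpha>)\<close> undoes the scaling of
      \<open>word_op W \<alpha>\<close> on the vacuum.\<close>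
    define X where "X = (\<Sum>\<alpha>\<in>F. scale_op (coord x \<alpha> * sqrt (b \<alpha>)) (word_op W \<alpha>))"
    have "X \<in> A"
      unfolding X_def
      by (intro cstar_subalgebra_sum[OF A(1)] cstar_subalgebraD(5)[OF A(1)] cstar_subalgebra_word_op A)
    moreover have "sqrt (b \<alpha>) \<noteq> 0" for \<alpha> using pos[of \<alpha>] by simp
    hence "X (ell2_basis []) = ?s F"
      by (simp add: X_def blinfun.sum_left word_op_W_vacuum scaleR_scaleC scaleC_scaleC)
    ultimately show ?thesis using le[of X] by simp
  qed
  hence le: "\<forall>\<^sub>F F in finite_subsets_at_top UNIV. norm (T (?s F)) \<le> c * norm (?s F)" by simp
  have "((\<lambda>F. norm (T (?s F))) \<longlongrightarrow> norm (T x)) (finite_subsets_at_top UNIV)"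
    "((\<lambda>F. c * norm (?s F)) \<longlongrightarrow> c * norm x) (finite_subsets_at_top UNIV)"
    by (intro tendsto_intros ell2_basis_expansion)+
  from tendsto_le[OF finite_subsets_at_top_neq_bot this(2,1) le] show ?thesis .
qed

text \<open>Contractivity gives one inequality. For the other, a vector \<open>\<xi>\<close> fixed
  by \<open>\<pi> P\<close> reproduces the vacuum functional up to the factor
  \<open>cinner \<xi> \<xi>\<close>, so \<open>\<pi>\<close> copies the action of the algebra on the
  vacuum orbit.\<close>

lemma non_Cuntz_rep_isometric:
  fixes \<pi> :: "('n fock \<Rightarrow>\<^sub>L 'n fock) \<Rightarrow> ('k::complex_hilbert \<Rightarrow>\<^sub>L 'k)"
  assumes inv: "nc_inverse b a"
    and sm: "summable (\<lambda>k. \<Sum>\<alpha> | length \<alpha> = k. a \<alpha> *\<^sub>R (word_op W \<alpha> o\<^sub>L adj (word_op W \<alpha>)))"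
    and rep: "unital_star_rep (Cstar W) \<pi>"
    and nC: "\<not> Cuntz_type a W \<pi>"
    and T: "T \<in> Cstar W"
  shows "norm (\<pi> T) = norm T"
proof -
  note C = cstar_subalgebra_Cstar[of W, OF clinear_W]
  interpret cstar_rep "Cstar W" \<pi> using C rep by unfold_locales
  let ?t = "\<lambda>k. \<Sum>\<alpha> | length \<alpha> = k. a \<alpha> *\<^sub>R (word_op W \<alpha> o\<^sub>L adj (word_op W \<alpha>))"
  let ?e = "ell2_basis [] :: 'n fock"
  have w: "word_op W \<alpha> \<in> Cstar W" for \<alpha> by (intro cstar_subalgebra_word_op C)
  have wa: "word_op W \<alpha> o\<^sub>L adj (word_op W \<alpha>) \<in> Cstar W" for \<alpha> by (intro algD(4,6) w)
  have t: "?t k \<in> Cstar W" for k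
    by (intro cstar_subalgebra_sum[OF alg] cstar_subalgebra_scaleR[OF alg] wa)
  obtain P where P: "?t sums P" using sm by (auto simp: summable_def)
  have Papp: "P x = coord x [] *\<^sub>C ?e" for x by (rule defect_limit[OF inv P])
  have partial: "(\<Sum>k<n. ?t k) \<in> Cstar W" for n by (intro cstar_subalgebra_sum[OF alg] t)
  have PA: "P \<in> Cstar W" and "(\<lambda>n. \<pi> (\<Sum>k<n. ?t k)) \<longlonglongrightarrow> \<pi> P"
    using rep_tendsto[of "\<lambda>n. \<Sum>k<n. ?t k" P] partial P by (auto simp: sums_def)
  \<comment> \<open>These are the partial sums in the Cuntz condition, so \<open>\<pi> P\<close> is
    their limit; if it were 0, then \<open>\<pi>\<close> would be of Cuntz type.\<close>
  moreover have "\<pi> (\<Sum>k<n. ?t k) = (\<Sum>k<n. \<Sum>\<alpha> | length \<alpha> = k. a \<alpha> *\<^sub>R (\<pi> (word_op W \<alpha>) o\<^sub>L adj (\<pi> (word_op W \<alpha>))))" for n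
    using wa w algD t by (simp add: rep_sum cstar_subalgebra_scaleR[OF alg] rep_scaleR rep_hom)
  ultimately have "\<pi> P \<noteq> 0"
    using nC by (auto simp: Cuntz_type_def sums_def)
  then obtain x where x: "\<pi> P x \<noteq> 0" by (metis blinfun_eqI zero_blinfun.rep_eq)
  define \<xi> where "\<xi> = \<pi> P x"
  \<comment> \<open>\<open>P\<close> has rank one, so compressing by it leaves a single matrix
    entry.\<close>
  have compress: "P o\<^sub>L (T o\<^sub>L P) = scale_op (cinner (T ?e) ?e) P" if "T \<in> Cstar W" for T
    using algD(1)[OF that]
    by (intro blinfun_eqI)
      (simp add: Papp clinear_op_def scaleC_ell2.rep_eq cinner_ell2_basis scaleC_scaleC mult.commute)
  have "P o\<^sub>L P = P"
    by (rule blinfun_eqI) (simp add: Papp scaleC_ell2.rep_eq ell2_basis.rep_eq)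
  hence \<xi>: "\<pi> P \<xi> = \<xi>"
    using rep_hom(3)[OF PA PA] by (simp add: \<xi>_def blinfun_apply_blinfun_compose[symmetric])
  have "adj P = P"
    by (rule adj_eqI)
      (simp add: Papp cinner_scaleC_left cinner_scaleC_right cinner_ell2_basis[symmetric] cinner_commute[of ?e])
  hence adjP: "adj (\<pi> P) = \<pi> P" using rep_hom(5)[OF PA] by simp
  have state: "cinner (\<pi> T \<xi>) \<xi> = cinner (T ?e) ?e * cinner \<xi> \<xi>" if "T \<in> Cstar W" for T
  proof -
    \<comment> \<open>Both copies of \<open>\<xi>\<close> absorb \<open>\<pi> P\<close>;
      self-adjointness moves the second one to the left argument.\<close>
    have "cinner (\<pi> T \<xi>) \<xi> = cinner (\<pi> P (\<pi> T (\<pi> P \<xi>))) \<xi>"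
      by (simp add: cinner_adj rep_hom PA adjP \<xi>)
    also have "\<pi> P (\<pi> T (\<pi> P \<xi>)) = \<pi> (P o\<^sub>L (T o\<^sub>L P)) \<xi>"
      using that PA algD by (simp add: rep_hom)
    finally show ?thesis using PA \<xi> by (simp add: compress[OF that] rep_hom cinner_scaleC_left)
  qed
  have orbit: "norm (\<pi> T \<xi>) = norm (T ?e) * norm \<xi>" if T: "T \<in> Cstar W" for T
  proof -
    \<comment> \<open>This is \<open>state\<close> for the product of \<open>adj T\<close> and
      \<open>T\<close>.\<close>
    have "complex_of_real ((norm (\<pi> T \<xi>))\<^sup>2) = cinner (T ?e) (T ?e) * cinner \<xi> \<xi>"
      using T algD by (simp only: rep_norm_sq state) (simp add: cinner_adj_left)
    also have "\<dots> = complex_of_real ((norm (T ?e) * norm \<xi>)\<^sup>2)"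
      by (simp add: cinner_self power_mult_distrib)
    finally have "(norm (\<pi> T \<xi>))\<^sup>2 = (norm (T ?e) * norm \<xi>)\<^sup>2" by (simp only: of_real_eq_iff)
    thus ?thesis by simp
  qed
  have "norm T \<le> norm (\<pi> T)"
  proof (rule norm_blinfun_bound, rule norm_ge_zero, rule norm_le_on_vacuum_orbit[OF C])
    fix X assume X: "X \<in> Cstar W"
    \<comment> \<open>\<open>orbit\<close> is used for the product \<open>T o\<^sub>L X\<close> here
      and for \<open>X\<close> next; the nonzero \<open>norm \<xi>\<close> then cancels.\<close>
    have "norm (T (X ?e)) * norm \<xi> = norm (\<pi> T (\<pi> X \<xi>))"
      using orbit[of "T o\<^sub>L X"] T X algD by (simp add: rep_hom)
    also have "\<dots> \<le> norm (\<pi> T) * (norm (X ?e) * norm \<xi>)"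
      unfolding orbit[OF X, symmetric] by (rule norm_blinfun)
    finally show "norm (T (X ?e)) \<le> norm (\<pi> T) * norm (X ?e)"
      using x by (simp add: \<xi>_def mult.assoc[symmetric])
  qed
  thus ?thesis using rep_norm_le[OF T] by simp
qed

end

theorem theorem5p12:
  fixes b a :: "'n::finite list \<Rightarrow> real"
    and W :: "'n \<Rightarrow> ('n fock \<Rightarrow>\<^sub>L 'n fock)"
    and \<pi> :: "('n fock \<Rightarrow>\<^sub>L 'n fock) \<Rightarrow> ('k::complex_hilbert \<Rightarrow>\<^sub>L 'k)"
    and V :: "'n \<Rightarrow> ('k \<Rightarrow>\<^sub>L 'k)"
  assumes "admissible b"
    and "nc_inverse b a"
    and "W = weighted_left_creation b"
    and "summable (\<lambda>k. \<Sum>\<alpha> | length \<alpha> = k. a \<alpha> *\<^sub>R (word_op W \<alpha> o\<^sub>L adj (word_op W \<alpha>)))"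
    and "separable_space (euclidean :: 'k topology)"
    and "unital_star_rep (Cstar W) \<pi>"
    and "V = (\<lambda>i. \<pi> (W i))"
    and "\<not> Cuntz_type a W \<pi>"
  shows "star_isomorphic (Cstar W) (Cstar V)"
proof -
  interpret weighted_shift b W
    using assms(1,3) by unfold_locales (auto simp: admissible_def)
  note C = cstar_subalgebra_Cstar[of W, OF clinear_W]
  interpret cstar_rep "Cstar W" \<pi> using C assms(6) by unfold_locales
  have iso: "norm (\<pi> T) = norm T" if "T \<in> Cstar W" for T
    by (rule non_Cuntz_rep_isometric[OF assms(2,4,6,8) that])
  have "inj_on \<pi> (Cstar W)"
  proof (rule inj_onI)
    fix S T assume ST: "S \<in> Cstar W" "T \<in> Cstar W" "\<pi> S = \<pi> T"
    thus "S = T" using iso[of "S - T"] by (simp add: rep_diff cstar_subalgebra_diff[OF alg])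
  qed
  moreover have "\<pi> ` Cstar W = Cstar V"
    unfolding assms(7) by (rule isometric_rep_image_Cstar[OF clinear_W assms(6) iso])
  moreover have "star_hom (Cstar W) \<pi>" using assms(6) by (simp add: unital_star_rep_def)
  \<comment> \<open>The isomorphism is \<open>\<pi>\<close> itself.\<close>
  ultimately show ?thesis unfolding star_isomorphic_def bij_betw_def by blast
qed

end
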